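(* Let $p\ge 1$ and let $n_1,\dots,n_p,r_1,\dots,r_p$ be non-negative integers such that $r_i\ge r_{i+1}+n_{i+1}+1$ for every $i\in\{1,\dots,p-1\}$. Let $P(k_1,\dots,k_p)\in\mathbb{Q}[k_1,\dots,k_p]$ satisfy $\deg_{k_i}P\le 3n_i+1$ for every $i\in\{1,\dots,p\}$. Let $\sigma_1,\dots,\sigma_p\in\{2,3\}$ and assume that for every $i\in\{1,\dots,p\}$, $$P(k_1,\dots,k_{i-1},-k_i-2r_i-n_i,k_{i+1},\dots,k_p)=(-1)^{n_i+1+\sigma_i}P(k_1,\dots,k_p).$$ Then there exist rational numbers $\lambda[s_1,\dots,s_q]$, indexed by the tuples $(s_1,\dots,s_q)\in\{2,3\}^q$ with $0\le q\le p$, such that $$\sum_{k_1\ge\dots\ge k_p\ge1}\frac{P(k_1,\dots,k_p)}{(k_1+r_1)_{n_1+1}^3\cdots(k_p+r_p)_{n_p+1}^3}=\sum_{q=0}^p\sum_{(s_1,\dots,s_q)\in\{2,3\}^q}\lambda[s_1,\dots,s_q]\,\zeta(s_1,\dots,s_q),$$ and $\lambda[s_1,\dots,s_p]=0$ for every $(s_1,\dots,s_p)\in\{2,3\}^p$ with $(s_1,\dots,s_p)\neq(\sigma_1,\dots,\sigma_p)$.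
   Context: $(k)_\alpha=k(k+1)\cdots(k+\alpha-1)$ is the Pochhammer symbol. For integers $s_1\ge2$, $s_2,\dots,s_q\ge1$, the multiple zeta value is $\zeta(s_1,\dots,s_q)=\sum_{k_1>\dots>k_q\ge1}k_1^{-s_1}\cdots k_q^{-s_q}$; the tuple with $q=0$ gives $\zeta(\emptyset)=1$. The integer $q$ is the depth. *)

theory Defs
  imports "HOL-Analysis.Analysis" "HOL-Library.Poly_Mapping"
begin

text \<open>
  Polynomials with rational coefficients in variables indexed by the natural numbers: a finitely
  supported map from exponent vectors to coefficients, with the ring structure (convolution
  product) of \<^theory>\<open>HOL-Library.Poly_Mapping\<close>. Variables are indexed from 0, so
  $k_i$ is the variable with index $i - 1$, and tuples are lists indexed from 0.
\<close>

type_synonym rat_mpoly = "(nat \<Rightarrow>\<^sub>0 nat) \<Rightarrow>\<^sub>0 rat"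

definition mp_const :: "rat \<Rightarrow> rat_mpoly" where
  "mp_const c = Poly_Mapping.single 0 c"

definition mp_var :: "nat \<Rightarrow> rat_mpoly" where
  "mp_var i = Poly_Mapping.single (Poly_Mapping.single i 1) 1"

definition mp_vars :: "rat_mpoly \<Rightarrow> nat set" where
  "mp_vars P = (\<Union>m\<in>Poly_Mapping.keys P. Poly_Mapping.keys m)"

text \<open>The partial degree in one variable; the zero polynomial gets degree 0.\<close>

definition mp_degree_in :: "nat \<Rightarrow> rat_mpoly \<Rightarrow> nat" where
  "mp_degree_in i P = Max (insert 0 ((\<lambda>m. Poly_Mapping.lookup m i) ` Poly_Mapping.keys P))"

text \<open>
  Evaluation in an arbitrary commutative ring, where \<open>c\<close> embeds the coefficients. It is used for
  real values (\<open>c = of_rat\<close>) and for substitution of polynomials (\<open>c = mp_const\<close>).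
\<close>

definition mp_eval :: "(rat \<Rightarrow> 'a::comm_ring_1) \<Rightarrow> (nat \<Rightarrow> 'a) \<Rightarrow> rat_mpoly \<Rightarrow> 'a" where
  "mp_eval c x P = (\<Sum>m\<in>Poly_Mapping.keys P.
     c (Poly_Mapping.lookup P m) * (\<Prod>j\<in>Poly_Mapping.keys m. x j ^ Poly_Mapping.lookup m j))"

definition mp_subst :: "nat \<Rightarrow> rat_mpoly \<Rightarrow> rat_mpoly \<Rightarrow> rat_mpoly" where
  "mp_subst i Q P = mp_eval mp_const (\<lambda>j. if j = i then Q else mp_var j) P"

definition noninc_tuples :: "nat \<Rightarrow> nat list set" where
  "noninc_tuples p = {k. length k = p \<and> sorted_wrt (\<ge>) k \<and> (\<forall>x\<in>set k. x \<ge> 1)}"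

definition dec_tuples :: "nat \<Rightarrow> nat list set" where
  "dec_tuples q = {k. length k = q \<and> sorted_wrt (>) k \<and> (\<forall>x\<in>set k. x \<ge> 1)}"

text \<open>
  The multiple zeta value; meaningful when all entries are at least 1 and the first is at least 2
  (the series then converges). For the empty tuple it is 1, since \<open>dec_tuples 0 = {[]}\<close>.
\<close>

definition mzv :: "nat list \<Rightarrow> real" where
  "mzv s = (\<Sum>\<^sub>\<infinity>k\<in>dec_tuples (length s). \<Prod>i<length s. 1 / real (k ! i) ^ (s ! i))"

definition tuples23 :: "nat \<Rightarrow> nat list set" where
  "tuples23 q = {s. length s = q \<and> set s \<subseteq> {2, 3}}"

end

theory Submission
  imports Defs
begin

text \<open>
  In each variable the symmetrised monomials divided by the cubed Pochhammer symbol are rational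
  combinations of \<open>1/(k + a)^\<sigma>\<close> and of differences \<open>1/(k + a)^s - 1/(k + a + 1)^s\<close> with \<open>s \<le> 3\<close>:
  the reflection \<open>k \<mapsto> -k - 2r - n\<close> permutes the poles, so that powers of the wrong parity only occur
  in differences, and decay of order 2 does the same for the residues. By multilinearity it
  suffices to treat products of such generators, whose poles are strictly separated by the
  condition on \<open>r\<close>.

  A difference in position \<open>i\<close> telescopes: summation over \<open>k\<^sub>i\<close> leaves boundary terms in which a
  power \<open>1/(k + a)^s\<close> multiplies a neighbouring factor. Since the poles are separated, the product
  splits into partial fractions of the same kind, with exponents at most 3, and the depth
  drops by one. If all factors are pure powers, lowering by one the shifts of the outer factors also
  costs only sums of smaller depth, and when the shifts are \<open>0, 1, 2, \<dots>\<close> the sum is a multiple zeta value.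
\<close>

section \<open>Partial fractions\<close>

text \<open>Rational combinations, with equality of functions required on \<open>D\<close> only, so that the junk
  values at the poles do not matter.\<close>

inductive_set rspan :: "'a set \<Rightarrow> ('a \<Rightarrow> real) set \<Rightarrow> ('a \<Rightarrow> real) set" for D G where
  zero: "(\<And>x. x \<in> D \<Longrightarrow> f x = 0) \<Longrightarrow> f \<in> rspan D G"
| step: "g \<in> G \<Longrightarrow> h \<in> rspan D G \<Longrightarrow> (\<And>x. x \<in> D \<Longrightarrow> f x = of_rat c * g x + h x) \<Longrightarrow> f \<in> rspan D G"

lemma rspan_cong:
  assumes "f \<in> rspan D G" "\<And>x. x \<in> D \<Longrightarrow> f' x = f x"
  shows "f' \<in> rspan D G"
  using assms
proof (induction arbitrary: f' rule: rspan.induct)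
  case (zero f)
  then show ?case by (intro rspan.zero) auto
next
  case (step g h f c)
  then show ?case by (simp add: rspan.step[of g G h D f' c])
qed

lemma rspan_gen: "g \<in> G \<Longrightarrow> g \<in> rspan D G"
  by (rule rspan.step[of g G "\<lambda>x. 0" D g 1]) (auto intro: rspan.zero)

lemma rspan_lin:
  assumes "f \<in> rspan D G" "h \<in> rspan D G"
  shows "(\<lambda>x. of_rat c * f x + h x) \<in> rspan D G"
  using assms(1)
proof (induction rule: rspan.induct)
  case (zero f)
  then show ?case by (intro rspan_cong[OF assms(2)]) auto
next
  case (step g h' f c')
  show ?case
    by (rule rspan.step[of g G "\<lambda>x. of_rat c * h' x + h x" D _ "c * c'", OF step(1) step.IH])
       (simp add: step.hyps(3) of_rat_mult algebra_simps)
qed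

lemma rspan_scale: "f \<in> rspan D G \<Longrightarrow> (\<lambda>x. of_rat c * f x) \<in> rspan D G"
  using rspan_lin[of f D G "\<lambda>x. 0" c] by (simp add: rspan.zero)

lemma rspan_add: "f \<in> rspan D G \<Longrightarrow> h \<in> rspan D G \<Longrightarrow> (\<lambda>x. f x + h x) \<in> rspan D G"
  using rspan_lin[of f D G h 1] by simp

lemma rspan_diff: "f \<in> rspan D G \<Longrightarrow> h \<in> rspan D G \<Longrightarrow> (\<lambda>x. f x - h x) \<in> rspan D G"
  using rspan_lin[of h D G f "-1"] by (simp add: of_rat_minus)

text \<open>The operator sending \<open>f\<close> to \<open>u * f + v * (f o t)\<close> is linear,
  so it is enough to check generators. Equality is known on \<open>D\<close> only, hence
  \<open>D'\<close> and its image under \<open>t\<close> must lie there. With \<open>v = 0\<close>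
  this is multiplication; with \<open>u = 1\<close> and a sign for \<open>v\<close> it is
  symmetrisation under a reflection.\<close>

lemma rspan_transfer:
  assumes "f \<in> rspan D G" "D' \<subseteq> D" and t: "\<And>x. x \<in> D' \<Longrightarrow> t x \<in> D"
    and "\<And>g. g \<in> G \<Longrightarrow> (\<lambda>x. u x * g x + v x * g (t x)) \<in> rspan D' G'"
  shows "(\<lambda>x. u x * f x + v x * f (t x)) \<in> rspan D' G'"
  using assms(1)
proof (induction rule: rspan.induct)
  case (zero f)
  then show ?case using assms by (intro rspan.zero) auto
next
  case (step g h f c)
  show ?case
  proof (rule rspan_cong[OF rspan_lin[OF assms(4)[OF step(1)] step(4), of c]])
    fix x assume "x \<in> D'"
    then have "x \<in> D" "t x \<in> D" using assms(2) t by auto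
    then show "u x * f x + v x * f (t x)
        = of_rat c * (u x * g x + v x * g (t x)) + (u x * h x + v x * h (t x))"
      by (simp add: step(3) algebra_simps)
  qed
qed

lemma rspan_mult:
  assumes "f \<in> rspan D G" "D' \<subseteq> D" "\<And>g. g \<in> G \<Longrightarrow> (\<lambda>x. u x * g x) \<in> rspan D' G'"
  shows "(\<lambda>x. u x * f x) \<in> rspan D' G'"
proof -
  have "(\<lambda>x. u x * f x + 0 * f x) \<in> rspan D' G'"
    by (rule rspan_transfer[OF assms(1,2)]) (use assms(2,3) in \<open>simp_all add: subset_iff\<close>)
  then show ?thesis by simp
qed

lemma rspan_mono:
  assumes "f \<in> rspan D G" "D' \<subseteq> D" "G \<subseteq> G'"
  shows "f \<in> rspan D' G'"
proof -
  have "(\<lambda>x. 1 * f x) \<in> rspan D' G'"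
    by (rule rspan_mult[OF assms(1,2)]) (use assms(3) in \<open>simp add: rspan_gen subset_iff\<close>)
  then show ?thesis by simp
qed

section \<open>Generators: pure powers and differences of neighbouring powers\<close>

definition pw :: "nat \<Rightarrow> nat \<Rightarrow> real \<Rightarrow> real" where
  "pw a s x = 1 / (x + real a) ^ s"

definition dpw :: "nat \<Rightarrow> nat \<Rightarrow> real \<Rightarrow> real" where
  "dpw a s x = pw a s x - pw (Suc a) s x"

text \<open>All poles are \<open>-a\<close> with \<open>b <= a < d\<close>. The set \<open>S\<close>
  restricts only the pure powers: it is \<open>{2,3}\<close> before symmetrisation and a singleton
  afterwards. A difference may have exponent 1, because it still decays quadratically.\<close>

definition gens :: "nat set \<Rightarrow> nat \<Rightarrow> nat \<Rightarrow> (real \<Rightarrow> real) set" where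
  "gens S b d = {pw a s |a s. b \<le> a \<and> a < d \<and> s \<in> S}
     \<union> {dpw a s |a s. b \<le> a \<and> Suc a < d \<and> s \<in> {1..3}}"

text \<open>Contains no pole \<open>-a\<close> with \<open>a < d\<close>. The negative part is needed because the reflection
  \<open>x \<mapsto> -x - 2r - n\<close> maps positive arguments there.\<close>

definition pole_free :: "nat \<Rightarrow> real set" where
  "pole_free d = {x. 0 < x \<or> x + real d < 1}"

lemma dpw_in_gens: "b \<le> a \<Longrightarrow> Suc a < d \<Longrightarrow> s \<in> {1..3} \<Longrightarrow> dpw a s \<in> gens S b d"
  unfolding gens_def by blast

lemma pw_in_gens: "b \<le> a \<Longrightarrow> a < d \<Longrightarrow> s \<in> S \<Longrightarrow> pw a s \<in> gens S b d"
  unfolding gens_def by blast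

lemma gens_cases:
  assumes "g \<in> gens S b d"
  obtains (pw) a s where "g = pw a s" "b \<le> a" "a < d" "s \<in> S"
  | (dpw) a s where "g = dpw a s" "b \<le> a" "Suc a < d" "s \<in> {1..3}"
  using assms unfolding gens_def by blast

lemma gens_mono: "S \<subseteq> S' \<Longrightarrow> b' \<le> b \<Longrightarrow> d \<le> d' \<Longrightarrow> gens S b d \<subseteq> gens S' b' d'"
  by (auto elim!: gens_cases intro!: pw_in_gens dpw_in_gens)

lemma pole_free_nonzero: "x \<in> pole_free d \<Longrightarrow> a < d \<Longrightarrow> x + real a \<noteq> 0"
  unfolding pole_free_def by auto

lemma pw_diff_le_rspan:
  assumes "b \<le> a" "a \<le> a'" "a' < d" "s \<in> {1..3}"
  shows "(\<lambda>x. pw a s x - pw a' s x) \<in> rspan D (gens S b d)"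
  using assms(2,3)
proof (induction a' rule: dec_induct)
  case base
  then show ?case by (simp add: rspan.zero)
next
  case (step c)
  have "(\<lambda>x. (pw a s x - pw c s x) + dpw c s x) \<in> rspan D (gens S b d)"
    using step assms by (intro rspan_add[OF _ rspan_gen] dpw_in_gens) auto
  then show ?case by (simp add: dpw_def)
qed

lemma pw_diff_rspan:
  assumes "b \<le> a" "a < d" "b \<le> a'" "a' < d" "s \<in> {1..3}"
  shows "(\<lambda>x. pw a s x - pw a' s x) \<in> rspan D (gens S b d)"
proof (cases "a \<le> a'")
  case True
  then show ?thesis using assms by (intro pw_diff_le_rspan) auto
next
  case False
  then have "(\<lambda>x. of_rat (-1) * (pw a' s x - pw a s x)) \<in> rspan D (gens S b d)"
    using assms by (intro rspan_scale pw_diff_le_rspan) auto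
  then show ?thesis by (simp add: of_rat_minus)
qed

section \<open>Partial fractions of monomials over products of linear factors\<close>

definition lin_prod :: "nat multiset \<Rightarrow> real \<Rightarrow> real" where
  "lin_prod M x = (\<Prod>a\<in>#M. x + real a)"

lemma lin_prod_simps [simp]:
  "lin_prod {#} x = 1" "lin_prod (add_mset a M) x = (x + real a) * lin_prod M x"
  "lin_prod (M + N) x = lin_prod M x * lin_prod N x"
  "lin_prod (replicate_mset s a) x = (x + real a) ^ s"
  by (simp_all add: lin_prod_def image_replicate_mset prod_mset_replicate_mset)

text \<open>Writing \<open>x = (x + a) - a\<close> lowers \<open>m\<close>, and two distinct shifts
  are separated by the difference of their reciprocals, which lowers the number of factors. The
  multiset keeps track of multiplicities; \<open>m + 2 <= size M\<close> is decay of order 2, which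
  prevents a lone simple pole.\<close>

lemma monomial_over_lin_prod_rspan:
  assumes "\<And>a. a \<in># M \<Longrightarrow> b \<le> a \<and> a < d" "\<And>a. count M a \<le> 3" "m + 2 \<le> size M"
  shows "(\<lambda>x. x ^ m / lin_prod M x) \<in> rspan (pole_free d) (gens {2,3} b d)"
  using assms
proof (induction "m + size M" arbitrary: m M rule: less_induct)
  case less
  have ne: "x + real a \<noteq> 0" if "x \<in> pole_free d" "a \<in># M" for x a
    using that less.prems(1) pole_free_nonzero by blast
  obtain a where a: "a \<in># M"
    using less.prems(3) by (cases M) auto
  obtain N where N: "M = add_mset a N"
    using a by (metis insert_DiffM)
  have sub_count: "count K e \<le> 3" if "K \<subseteq># M" for K e
    using less.prems(2)[of e] mset_subset_eq_count[OF that, of e] by linarith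
  have sub_mem: "b \<le> c \<and> c < d" if "K \<subseteq># M" "c \<in># K" for K c
    using less.prems(1)[of c] that by (auto dest: mset_subset_eqD)
  show ?case
  proof (cases m)
    case (Suc l)
    have 1: "(\<lambda>x. x ^ l / lin_prod N x) \<in> rspan (pole_free d) (gens {2,3} b d)"
      using less.prems(3) Suc sub_mem[of N] sub_count[of N] by (intro less.hyps) (auto simp: N)
    have 2: "(\<lambda>x. x ^ l / lin_prod M x) \<in> rspan (pole_free d) (gens {2,3} b d)"
      using less.prems Suc by (intro less.hyps) auto
    have "x * y / (u * w) = - c * (y / (u * w)) + y / w" if "u = x + c" "u \<noteq> 0" for x y u w c :: real
    proof -
      have "y / w = u * y / (u * w)" using that by simp
      then show ?thesis using that(1) by (simp add: ring_distribs add_divide_distrib)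
    qed
    from this[of "x + real a" x "real a" "x ^ l" "lin_prod N x" for x]
    show ?thesis
      using ne[OF _ a] by (intro rspan_cong[OF rspan_lin[OF 2 1, of "- of_nat a"]]) (simp add: N Suc of_rat_minus)
  next
    case 0
    show ?thesis
    proof (cases "\<exists>a'. a' \<in># N \<and> a' \<noteq> a")
      case False
      then have "set_mset N \<subseteq> {a}" by auto
      then have "N = replicate_mset (size N) a"
        by (metis set_mset_subset_singletonD)
      then have M: "M = replicate_mset (size M) a"
        using N by (metis replicate_mset_Suc size_add_mset)
      \<comment> \<open>One pole remains: multiplicity at most 3 and decay of order 2 leave only the
        exponents 2 and 3.\<close>
      have "size M \<le> 3" using less.prems(2)[of a] M by (metis count_replicate_mset)
      then have s: "size M \<in> {2,3}" using less.prems(3) by auto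
      have "lin_prod M x = (x + real a) ^ size M" for x
        by (subst M) simp
      then have "(\<lambda>x. x ^ m / lin_prod M x) = pw a (size M)"
        using 0 by (auto simp: pw_def)
      then show ?thesis
        using less.prems(1)[OF a] s by (auto intro!: rspan_gen pw_in_gens)
    next
      case True
      then obtain a' where "a' \<in># N" and a'2: "a' \<noteq> a" by blast
      then obtain L where L: "N = add_mset a' L" by (blast dest: multi_member_split)
      have a': "a' \<in># M" "a' \<noteq> a" using a'2 by (auto simp: N L)
      have eq: "1 / lin_prod M x = of_rat (1 / (of_nat a' - of_nat a)) * (1 / lin_prod (add_mset a L) x - 1 / lin_prod N x)"
        if x: "x \<in> pole_free d" for x
      proof -
        have "of_rat (1 / (of_nat a' - of_nat a)) = 1 / (real a' - real a)"
          by (simp add: of_rat_divide of_rat_diff)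
        moreover have "lin_prod L x \<noteq> 0"
          using ne[OF x] by (auto simp: lin_prod_def prod_mset_zero_iff N L)
        moreover have "1 / (u * (v * w)) = 1 / (v - u) * (1 / (u * w) - 1 / (v * w))"
          if "u \<noteq> 0" "v \<noteq> 0" "u \<noteq> v" "w \<noteq> 0" for u v w :: real
          using that by (simp add: divide_simps)
        from this[of "x + real a" "x + real a'" "lin_prod L x"]
        have "lin_prod L x \<noteq> 0 \<Longrightarrow> 1 / lin_prod M x
            = 1 / (real a' - real a) * (1 / lin_prod (add_mset a L) x - 1 / lin_prod N x)"
          using ne[OF x a] ne[OF x a'(1)] a'(2) by (simp add: N L)
        ultimately show ?thesis by simp
      qed
      have "(\<lambda>x. 1 / lin_prod (add_mset a L) x - 1 / lin_prod N x) \<in> rspan (pole_free d) (gens {2,3} b d)"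
      \<comment> \<open>With just two factors, each fraction is a simple pole and violates the
        degree bound of the induction hypothesis, but their difference lies in the span.\<close>
      proof (cases "L = {#}")
        case True
        then have "(\<lambda>x. 1 / lin_prod (add_mset a L) x - 1 / lin_prod N x) = (\<lambda>x. pw a 1 x - pw a' 1 x)"
          by (simp add: pw_def L)
        then show ?thesis
          using less.prems(1) a a' by (auto intro!: pw_diff_rspan)
      next
        case False
        then have "size L > 0" by (simp add: nonempty_has_size)
        then show ?thesis
          using less.hyps[of 0 N, OF _ sub_mem[of N] sub_count[of N]] 0
            less.hyps[of 0 "add_mset a L", OF _ sub_mem[of "add_mset a L"] sub_count[of "add_mset a L"]]
          by (intro rspan_diff) (auto simp: N L)
      qed
      from rspan_cong[OF rspan_scale[OF this, of "1 / (of_nat a' - of_nat a)"]]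
      show ?thesis using eq 0 by auto
    qed
  qed
qed

abbreviation (input) W :: "nat \<Rightarrow> nat \<Rightarrow> (real \<Rightarrow> real) set" where
  "W b d \<equiv> rspan {0<..} (gens {2,3} b d)"

lemma W_mono: "f \<in> W b d \<Longrightarrow> b' \<le> b \<Longrightarrow> d \<le> d' \<Longrightarrow> f \<in> W b' d'"
  by (erule rspan_mono) (simp_all add: gens_mono)

text \<open>As the poles differ, no multiplicity exceeds 3, and \<open>s + t >= 2\<close> gives the
  decay even for two simple poles.\<close>

lemma pw_mult_pw_W:
  assumes "a \<noteq> a'" "b \<le> a" "a < d" "b \<le> a'" "a' < d" "s \<in> {1..3}" "t \<in> {1..3}"
  shows "(\<lambda>x. pw a s x * pw a' t x) \<in> W b d"
proof -
  define M where "M = replicate_mset s a + replicate_mset t a'"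
  have "(\<lambda>x. x ^ 0 / lin_prod M x) \<in> rspan (pole_free d) (gens {2,3} b d)"
    using assms by (intro monomial_over_lin_prod_rspan) (auto simp: M_def split: if_splits)
  then have "(\<lambda>x. x ^ 0 / lin_prod M x) \<in> W b d"
    by (rule rspan_mono) (auto simp: pole_free_def)
  then show ?thesis by (simp add: M_def pw_def)
qed

text \<open>The new pole lies outside the interval of poles of \<open>f\<close>, so only powers with
  distinct poles are multiplied. In this way a boundary term of a telescoping sum is absorbed into a
  neighbouring factor.\<close>

lemma W_mult_pw:
  assumes f: "f \<in> W b d" and a: "a < b \<or> d \<le> a" "b' \<le> a" "a < d'" "b' \<le> b" "d \<le> d'" and s: "s \<in> {1..3}"
  shows "(\<lambda>x. pw a s x * f x) \<in> W b' d'"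
  using f
proof (rule rspan_mult)
  fix g assume "g \<in> gens {2,3} b d"
  then show "(\<lambda>x. pw a s x * g x) \<in> W b' d'"
  proof (cases rule: gens_cases)
    case (pw c t)
    then show ?thesis using a s unfolding \<open>g = _\<close> by (intro pw_mult_pw_W) auto
  next
    case (dpw c t)
    have "(\<lambda>x. pw a s x * pw c t x - pw a s x * pw (Suc c) t x) \<in> W b' d'"
      using dpw a s by (intro rspan_diff pw_mult_pw_W) auto
    then show ?thesis by (simp add: dpw(1) dpw_def algebra_simps)
  qed
qed auto

text \<open>The reflection moves the pole \<open>-a\<close> to \<open>-(2 * r + n - a)\<close> and
  gives a power of exponent \<open>s\<close> the sign \<open>(-1)^s\<close>. For
  \<open>s = \<sigma>\<close> two pure powers are added; the other exponent has the opposite parity,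
  so its powers are subtracted and form a difference.\<close>

lemma rspan_gens_symmetrise:
  assumes f: "f \<in> rspan (pole_free (Suc (r + n))) (gens {2,3} r (Suc (r + n)))" and \<sigma>: "\<sigma> \<in> {2,3}"
  shows "(\<lambda>x. f x + (- 1) ^ \<sigma> * f (- x - 2 * real r - real n))
    \<in> rspan {0<..} (gens {\<sigma>} r (Suc (r + n)))"
proof -
  have refl: "pw a s (- x - 2 * real r - real n) = (- 1) ^ s * pw (2 * r + n - a) s x"
    if "a \<le> r + n" for a s x
  proof -
    have "- x - 2 * real r - real n + real a = - (x + real (2 * r + n - a))"
      using that by (simp add: of_nat_diff)
    then have "(- x - 2 * real r - real n + real a) ^ s = (- 1) ^ s * (x + real (2 * r + n - a)) ^ s"
      by (metis power_minus)
    then show ?thesis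
      by (cases "even s") (simp_all add: pw_def)
  qed
  have "(\<lambda>x. 1 * f x + (- 1) ^ \<sigma> * f (- x - 2 * real r - real n))
    \<in> rspan {0<..} (gens {\<sigma>} r (Suc (r + n)))"
    using f
  proof (rule rspan_transfer)
    fix g assume "g \<in> gens {2,3} r (Suc (r + n))"
    then show "(\<lambda>x. 1 * g x + (- 1) ^ \<sigma> * g (- x - 2 * real r - real n))
        \<in> rspan {0<..} (gens {\<sigma>} r (Suc (r + n)))"
    proof (cases rule: gens_cases)
      case 1: (pw a s)
      let ?a = "2 * r + n - a"
      have a: "r \<le> ?a" "?a \<le> r + n" using 1 by auto
      have eq: "1 * g x + (- 1) ^ \<sigma> * g (- x - 2 * real r - real n) = pw a s x + (- 1) ^ (\<sigma> + s) * pw ?a s x" for x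
        using 1 refl by (simp add: power_add)
      show ?thesis
      proof (cases "s = \<sigma>")
        case True
        have "(\<lambda>x. pw a s x + pw ?a s x) \<in> rspan {0<..} (gens {\<sigma>} r (Suc (r + n)))"
          using 1 a True by (intro rspan_add rspan_gen pw_in_gens) auto
        moreover have "(- 1 :: real) ^ (\<sigma> + s) = 1" using True by simp
        ultimately show ?thesis unfolding eq by simp
      next
        case False
        then have "(- 1 :: real) ^ (\<sigma> + s) = - 1" using \<sigma> 1 by auto
        moreover have "(\<lambda>x. pw a s x - pw ?a s x) \<in> rspan {0<..} (gens {\<sigma>} r (Suc (r + n)))"
          using 1 a by (intro pw_diff_rspan) auto
        ultimately show ?thesis unfolding eq by simp
      qed
    next
      case 2: (dpw a s)
      \<comment> \<open>The reflection exchanges the two ends of a difference: the image of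
        \<open>Suc a\<close> is the new lower end, at the cost of one more sign.\<close>
      let ?a = "2 * r + n - Suc a"
      have a: "r \<le> ?a" "Suc ?a \<le> r + n" "2 * r + n - a = Suc ?a" using 2 by auto
      have eq: "1 * g x + (- 1) ^ \<sigma> * g (- x - 2 * real r - real n)
          = of_rat (- ((- 1) ^ (\<sigma> + s))) * dpw ?a s x + dpw a s x" for x
        using 2 refl[of a s x] refl[of "Suc a" s x] a(3)
        by (simp add: dpw_def power_add of_rat_minus of_rat_mult of_rat_power algebra_simps)
      show ?thesis unfolding eq
        using 2 a by (intro rspan_lin rspan_gen dpw_in_gens) auto
    qed
  qed (auto simp: pole_free_def)
  then show ?thesis by simp
qed

section \<open>Nested sums\<close>

definition quad_decay :: "(real \<Rightarrow> real) \<Rightarrow> bool" where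
  "quad_decay f \<longleftrightarrow> (\<exists>C\<ge>0. \<forall>x\<ge>1. \<bar>f x\<bar> \<le> C / x ^ 2)"

lemma quad_decay_lin:
  assumes "quad_decay g" "quad_decay h" "\<And>x. x > 0 \<Longrightarrow> f x = c * g x + h x"
  shows "quad_decay f"
proof -
  obtain C C' where C: "C \<ge> 0" "\<And>x. x \<ge> 1 \<Longrightarrow> \<bar>g x\<bar> \<le> C / x ^ 2"
    and C': "C' \<ge> 0" "\<And>x. x \<ge> 1 \<Longrightarrow> \<bar>h x\<bar> \<le> C' / x ^ 2"
    using assms(1,2) unfolding quad_decay_def by blast
  have "\<bar>f x\<bar> \<le> (\<bar>c\<bar> * C + C') / x ^ 2" if "x \<ge> 1" for x
  proof -
    have "\<bar>f x\<bar> \<le> \<bar>c\<bar> * \<bar>g x\<bar> + \<bar>h x\<bar>"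
      using that assms(3)[of x] abs_triangle_ineq[of "c * g x" "h x"] by (simp add: abs_mult)
    also have "\<dots> \<le> \<bar>c\<bar> * (C / x ^ 2) + C' / x ^ 2"
      using that by (intro add_mono mult_left_mono C C') auto
    finally show ?thesis by (simp add: add_divide_distrib)
  qed
  then show ?thesis
    unfolding quad_decay_def using C(1) C'(1) by (intro exI[of _ "\<bar>c\<bar> * C + C'"]) auto
qed

lemma quad_decay_zero: "(\<And>x. x > 0 \<Longrightarrow> f x = 0) \<Longrightarrow> quad_decay f"
  unfolding quad_decay_def by (intro exI[of _ 0]) auto

lemma quad_decay_pw:
  assumes "s \<ge> 2"
  shows "quad_decay (pw a s)"
proof -
  have "\<bar>pw a s x\<bar> \<le> 1 / x ^ 2" if "x \<ge> 1" for x
  proof -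
    have "x ^ 2 \<le> (x + real a) ^ 2" using that by (intro power_mono) auto
    also have "\<dots> \<le> (x + real a) ^ s" using that assms by (intro power_increasing) auto
    finally show ?thesis
      using that by (simp add: pw_def frac_le)
  qed
  then show ?thesis unfolding quad_decay_def by (intro exI[of _ 1]) auto
qed

text \<open>For \<open>s = 1\<close> neither power decays quadratically, but the difference equals
  \<open>1 / ((x + a) * (x + a + 1))\<close>.\<close>

lemma quad_decay_dpw:
  assumes "s \<ge> 1"
  shows "quad_decay (dpw a s)"
proof (cases "s = 1")
  case False
  then show ?thesis
    using assms by (intro quad_decay_lin[where f = "dpw a s" and g = "pw (Suc a) s" and h = "pw a s" and c = "-1"]
        quad_decay_pw) (auto simp: dpw_def)
next
  case True
  have "\<bar>dpw a s x\<bar> \<le> 1 / x ^ 2" if "x \<ge> 1" for x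
  proof -
    have "dpw a s x = 1 / ((x + real a) * (x + real (Suc a)))"
      using True that by (simp add: dpw_def pw_def divide_simps)
    moreover have "x ^ 2 \<le> (x + real a) * (x + real (Suc a))"
      unfolding power2_eq_square using that by (intro mult_mono) auto
    ultimately show ?thesis using that by (simp add: frac_le)
  qed
  then show ?thesis unfolding quad_decay_def by (intro exI[of _ 1]) auto
qed

lemma quad_decay_gens: "S \<subseteq> {2,3} \<Longrightarrow> g \<in> gens S b d \<Longrightarrow> quad_decay g"
  by (erule gens_cases) (auto intro!: quad_decay_pw quad_decay_dpw)

lemma quad_decay_rspan:
  assumes "f \<in> rspan {0<..} (gens S b d)" "S \<subseteq> {2,3}"
  shows "quad_decay f"
  using assms(1)
proof (induction rule: rspan.induct)
  case (zero f)
  then show ?case by (intro quad_decay_zero) auto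
next
  case (step g h f c)
  show ?case
    by (rule quad_decay_lin[OF quad_decay_gens[OF assms(2) step.hyps(1)] step.IH step.hyps(3)]) simp
qed

section \<open>Iterated sums: convergence and linearity\<close>

text \<open>Sum over \<open>m \<le> k\<^sub>1\<close>, \<open>k\<^sub>1 + e \<le> k\<^sub>2\<close>, \<open>\<dots>\<close>: the list starts with the factor of the smallest index,
  which reverses the order of the paper. The sums in question have \<open>e = 0\<close>, multiple zeta values
  have \<open>e = 1\<close>.\<close>

fun nest :: "nat \<Rightarrow> (real \<Rightarrow> real) list \<Rightarrow> nat \<Rightarrow> real" where
  "nest e [] m = 1"
| "nest e (f # fs) m = suminf (\<lambda>k. f (real (m + k)) * nest e fs (m + k + e))"

lemma summable_inverse_Suc_squares: "summable (\<lambda>k. 1 / real (Suc k) ^ 2)"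
  using inverse_power_summable[of 2, where 'a = real] 
  by (subst summable_Suc_iff[of "\<lambda>k. 1 / real k ^ 2"]) (simp add: field_simps)

text \<open>By induction on the list the inner sums are bounded uniformly in \<open>m\<close>, so
  the next summand is dominated by a multiple of \<open>1 / (k + 1)^2\<close>. The two claims are
  proved together because the bound at each level rests on absolute summability there.\<close>

lemma nest_aux:
  assumes "\<forall>f\<in>set fs. quad_decay f"
  shows nest_bounded: "\<exists>C\<ge>0. \<forall>m\<ge>1. \<bar>nest e fs m\<bar> \<le> C"
    and nest_abs_summable: "quad_decay f \<Longrightarrow> m \<ge> 1 \<Longrightarrow> summable (\<lambda>k. \<bar>f (real (m + k)) * nest e fs (m + k + e)\<bar>)"
proof -
  have key: "\<exists>C\<ge>0. \<forall>m\<ge>1. \<forall>k. \<bar>f (real (m + k)) * nest e fs (m + k + e)\<bar> \<le> C * (1 / real (Suc k) ^ 2)"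
    if "\<exists>C\<ge>0. \<forall>m\<ge>1. \<bar>nest e fs m\<bar> \<le> C" "quad_decay f" for f fs
  proof -
    from that obtain C C' where C: "C \<ge> 0" "\<And>m. m \<ge> 1 \<Longrightarrow> \<bar>nest e fs m\<bar> \<le> C"
      and C': "C' \<ge> 0" "\<And>x. x \<ge> 1 \<Longrightarrow> \<bar>f x\<bar> \<le> C' / x ^ 2"
      unfolding quad_decay_def by blast
    have "\<bar>f (real (m + k)) * nest e fs (m + k + e)\<bar> \<le> (C' * C) * (1 / real (Suc k) ^ 2)" if "m \<ge> 1" for m k
    proof -
      have "\<bar>f (real (m + k))\<bar> \<le> C' / real (m + k) ^ 2"
        using that by (intro C') auto
      \<comment> \<open>From \<open>m >= 1\<close> follows \<open>m + k >= k + 1\<close>; the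
        majorant thus does not depend on \<open>m\<close>.\<close>
      also have "\<dots> \<le> C' / real (Suc k) ^ 2"
        using that C'(1) by (intro divide_left_mono power_mono mult_pos_pos) auto
      finally have "\<bar>f (real (m + k))\<bar> * \<bar>nest e fs (m + k + e)\<bar> \<le> (C' / real (Suc k) ^ 2) * C"
        using that C' by (intro mult_mono C) auto
      then show ?thesis by (simp add: abs_mult mult_ac)
    qed
    then show ?thesis using C(1) C'(1) by (intro exI[of _ "C' * C"]) auto
  qed
  have summ: "summable (\<lambda>k. \<bar>f (real (m + k)) * nest e fs (m + k + e)\<bar>)"
    if bd: "\<exists>C\<ge>0. \<forall>m\<ge>1. \<bar>nest e fs m\<bar> \<le> C" and qd: "quad_decay f" and m: "m \<ge> 1" for f fs m
  proof -
    obtain C where "\<And>k. \<bar>f (real (m + k)) * nest e fs (m + k + e)\<bar> \<le> C * (1 / real (Suc k) ^ 2)"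
      using key[OF bd qd] m by blast
    then show ?thesis
      by (intro summable_comparison_test'[OF summable_mult[OF summable_inverse_Suc_squares, of C], of 0]) auto
  qed
  have bdd: "\<exists>C\<ge>0. \<forall>m\<ge>1. \<bar>nest e fs m\<bar> \<le> C" if "\<forall>f\<in>set fs. quad_decay f" for fs
    using that
  proof (induction fs)
    case Nil
    then show ?case by (intro exI[of _ 1]) auto
  next
    case (Cons f fs)
    then have IH: "\<exists>C\<ge>0. \<forall>m\<ge>1. \<bar>nest e fs m\<bar> \<le> C" "quad_decay f" by auto
    from key[OF this] obtain C where C: "C \<ge> 0"
      "\<And>m k. m \<ge> 1 \<Longrightarrow> \<bar>f (real (m + k)) * nest e fs (m + k + e)\<bar> \<le> C * (1 / real (Suc k) ^ 2)"
      by blast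
    let ?S = "suminf (\<lambda>k. 1 / real (Suc k) ^ 2)"
    have "\<bar>nest e (f # fs) m\<bar> \<le> C * ?S" if m: "m \<ge> 1" for m
    proof -
      have "\<bar>nest e (f # fs) m\<bar> \<le> suminf (\<lambda>k. \<bar>f (real (m + k)) * nest e fs (m + k + e)\<bar>)"
        using summable_rabs[OF summ[OF IH m]] by simp
      also have "\<dots> \<le> suminf (\<lambda>k. C * (1 / real (Suc k) ^ 2))"
        using C(2)[OF m] by (intro suminf_le summ[OF IH m] summable_mult summable_inverse_Suc_squares) auto
      also have "\<dots> = C * ?S" by (rule suminf_mult[OF summable_inverse_Suc_squares])
      finally show ?thesis .
    qed
    moreover have "?S \<ge> 0" by (intro suminf_nonneg summable_inverse_Suc_squares) auto
    ultimately show ?case using C(1) by (intro exI[of _ "C * ?S"]) auto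
  qed
  show "\<exists>C\<ge>0. \<forall>m\<ge>1. \<bar>nest e fs m\<bar> \<le> C" by (rule bdd[OF assms])
  show "quad_decay f \<Longrightarrow> m \<ge> 1 \<Longrightarrow> summable (\<lambda>k. \<bar>f (real (m + k)) * nest e fs (m + k + e)\<bar>)"
    by (rule summ[OF bdd[OF assms]])
qed

lemma nest_summable:
  "\<forall>f\<in>set fs. quad_decay f \<Longrightarrow> quad_decay f \<Longrightarrow> m \<ge> 1 \<Longrightarrow>
     summable (\<lambda>k. f (real (m + k)) * nest e fs (m + k + e))"
  by (rule summable_rabs_cancel[OF nest_abs_summable])

lemma nest_Cons_split:
  assumes "\<forall>f\<in>set fs. quad_decay f" "quad_decay f" "m \<ge> 1"
  shows "nest e (f # fs) m = f (real m) * nest e fs (m + e) + nest e (f # fs) (Suc m)"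
  using suminf_split_head[OF nest_summable[OF assms, of e]] by simp

lemma nest_shift: "nest 0 (map (\<lambda>f x. f (x + 1)) fs) m = nest 0 fs (Suc m)"
  by (induction fs arbitrary: m) (simp_all add: add_ac)

text \<open>A linear relation between tails that holds for every start survives summation over the
  smaller indices. Identities therefore need only be proved at the head of a list.\<close>

lemma nest_append_lin:
  assumes "\<And>k. k \<ge> 1 \<Longrightarrow> nest e X k = c * nest e Y k + d * nest e Z k"
    and "\<forall>f \<in> set pre \<union> set X \<union> set Y \<union> set Z. quad_decay f" and "m \<ge> 1"
  shows "nest e (pre @ X) m = c * nest e (pre @ Y) m + d * nest e (pre @ Z) m"
  using assms(2,3)
proof (induction pre arbitrary: m)
  case Nil
  then show ?case using assms(1) by simp
next
  case (Cons f pre)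
  have s: "summable (\<lambda>k. f (real (m + k)) * nest e (pre @ U) (m + k + e))" if "U \<in> {X, Y, Z}" for U
    using Cons.prems that by (intro nest_summable) auto
  have "nest e ((f # pre) @ X) m = suminf (\<lambda>k. c * (f (real (m + k)) * nest e (pre @ Y) (m + k + e))
      + d * (f (real (m + k)) * nest e (pre @ Z) (m + k + e)))"
    using Cons by (auto simp: algebra_simps intro!: suminf_cong)
  also have "\<dots> = c * nest e ((f # pre) @ Y) m + d * nest e ((f # pre) @ Z) m"
    unfolding append_Cons nest.simps
    by (intro sums_unique[symmetric] sums_add sums_mult summable_sums s) auto
  finally show ?case .
qed

lemma nest_lin_position:
  assumes "\<And>x. x > 0 \<Longrightarrow> f x = c * g x + h x"
    and "\<forall>f \<in> {f, g, h} \<union> set pre \<union> set suf. quad_decay f" "m \<ge> 1"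
  shows "nest e (pre @ f # suf) m = c * nest e (pre @ g # suf) m + nest e (pre @ h # suf) m"
proof -
  have "nest e (f # suf) k = c * nest e (g # suf) k + 1 * nest e (h # suf) k" if "k \<ge> 1" for k
  proof -
    have "nest e (f # suf) k = suminf (\<lambda>j. c * (g (real (k + j)) * nest e suf (k + j + e))
      + h (real (k + j)) * nest e suf (k + j + e))"
      using that assms(1) by (auto simp: algebra_simps intro!: suminf_cong)
    also have "\<dots> = c * nest e (g # suf) k + nest e (h # suf) k"
      unfolding nest.simps using that assms(2)
      by (intro sums_unique[symmetric] sums_add sums_mult summable_sums nest_summable) auto
    finally show ?thesis by simp
  qed
  from nest_append_lin[OF this, where m = m and pre = pre] show ?thesis using assms(2,3) by auto
qed

lemma nest_zero_position:
  assumes "\<And>x. x > 0 \<Longrightarrow> f x = 0" "\<forall>f \<in> set pre \<union> set suf. quad_decay f" "m \<ge> 1"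
  shows "nest e (pre @ f # suf) m = 0"
  \<comment> \<open>From \<open>f = 1 * f + f\<close> the sum equals twice itself.\<close>
  using nest_lin_position[of f 1 f f pre suf m e] assms quad_decay_zero[of f] by auto

section \<open>Telescoping and summation by parts\<close>

lemma pw_tendsto_0:
  assumes "s \<ge> 1" "m \<ge> 1"
  shows "(\<lambda>k. pw a s (real (m + k))) \<longlonglongrightarrow> 0"
proof (rule Lim_null_comparison[OF always_eventually LIMSEQ_inverse_real_of_nat], intro allI)
  fix k
  have "real (Suc k) \<le> (real (m + k) + real a) ^ 1" using assms by simp
  also have "\<dots> \<le> (real (m + k) + real a) ^ s" using assms by (intro power_increasing) auto
  finally show "norm (pw a s (real (m + k))) \<le> inverse (real (Suc k))"
    by (simp add: pw_def divide_simps)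
qed

lemma nest_dpw_Nil:
  assumes "s \<ge> 1" "m \<ge> 1"
  shows "nest e [dpw a s] m = pw a s (real m)"
proof -
  have "dpw a s (real (m + k)) = pw a s (real (m + k)) - pw a s (real (m + Suc k))" for k
    by (simp add: dpw_def pw_def add_ac)
  then have "(\<lambda>k. dpw a s (real (m + k))) sums pw a s (real m)"
    using telescope_sums'[OF pw_tendsto_0[OF assms]] by simp
  then show ?thesis by (simp add: sums_iff)
qed

text \<open>Summation by parts: for the remaining sum \<open>?B\<close>, the difference
  \<open>?B k - ?B (Suc k)\<close> is \<open>f k\<close> times the next inner sum. What is left is
  the boundary value at \<open>m\<close> and a sum in which \<open>f\<close> has absorbed the power
  at the upper end of the difference.\<close>

lemma nest_dpw_Cons:
  assumes "s \<ge> 1" "m \<ge> 1" "quad_decay f" "\<forall>f \<in> set fs. quad_decay f"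
    and "quad_decay (\<lambda>x. pw (Suc a) s x * f x)"
  shows "nest 0 (dpw a s # f # fs) m
    = pw a s (real m) * nest 0 (f # fs) m - nest 0 ((\<lambda>x. pw (Suc a) s x * f x) # fs) m"
proof -
  let ?g = "\<lambda>x. pw (Suc a) s x * f x" and ?B = "nest 0 (f # fs)"
  have B: "?B k = f (real k) * nest 0 fs k + ?B (Suc k)" if "k \<ge> 1" for k
    using nest_Cons_split[OF assms(4,3) that, of 0] by simp
  \<comment> \<open>The boundary term at infinity vanishes, being a null sequence times a bounded
    one.\<close>
  have lim: "(\<lambda>k. pw a s (real (m + k)) * ?B (m + k)) \<longlonglongrightarrow> 0"
  proof -
    obtain C where C: "\<And>k. k \<ge> 1 \<Longrightarrow> \<bar>?B k\<bar> \<le> C"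
      using nest_bounded[of "f # fs" 0] assms by (auto simp del: nest.simps)
    have "Zfun (\<lambda>k. pw a s (real (m + k))) sequentially"
      using pw_tendsto_0[OF assms(1,2)] by (simp add: tendsto_Zfun_iff)
    moreover have "Bfun (\<lambda>k. ?B (m + k)) sequentially"
      using C assms(2) by (intro BfunI[where K = C]) (auto simp del: nest.simps)
    ultimately have "Zfun (\<lambda>k. pw a s (real (m + k)) * ?B (m + k)) sequentially"
      by (rule bounded_bilinear.Zfun_prod_Bfun[OF bounded_bilinear_mult])
    then show ?thesis by (simp add: tendsto_Zfun_iff)
  qed
  have eq: "dpw a s (real (m + k)) * ?B (m + k) = (pw a s (real (m + k)) * ?B (m + k)
      - pw a s (real (m + Suc k)) * ?B (m + Suc k)) - ?g (real (m + k)) * nest 0 fs (m + k)" for k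
  proof -
    have p: "pw (Suc a) s (real (m + k)) = pw a s (real (m + Suc k))"
      by (simp add: pw_def add_ac)
    have alg: "(u - v) * y = (u * y - v * z) - v * c * w" if "y = c * w + z" for u v y z c w :: real
      by (simp add: that algebra_simps)
    have "?B (m + k) = f (real (m + k)) * nest 0 fs (m + k) + ?B (m + Suc k)"
      using B[of "m + k"] assms(2) unfolding add_Suc_right by linarith
    from alg[OF this] show ?thesis unfolding dpw_def p .
  qed
  have "(\<lambda>k. pw a s (real (m + k)) * ?B (m + k) - pw a s (real (m + Suc k)) * ?B (m + Suc k))
      sums (pw a s (real m) * ?B m)"
    using telescope_sums'[OF lim] by (simp only: add_0_right diff_0_right)
  moreover have "(\<lambda>k. ?g (real (m + k)) * nest 0 fs (m + k)) sums nest 0 (?g # fs) m"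
    using summable_sums[OF nest_summable[OF assms(4,5,2), of 0]] by (simp only: nest.simps add_0_right)
  ultimately have "(\<lambda>k. dpw a s (real (m + k)) * ?B (m + k)) sums
      (pw a s (real m) * ?B m - nest 0 (?g # fs) m)"
    unfolding eq by (rule sums_diff)
  then show ?thesis
    unfolding nest.simps(2)[of 0 "dpw a s"] add_0_right by (rule sums_unique[symmetric])
qed

text \<open>Raising the arguments of the tail by one makes the inequality between the first two
  indices strict. The missing diagonal terms merge \<open>f\<close> and \<open>g\<close> into one
  factor and have one summation less.\<close>

lemma nest_Cons_shift:
  assumes "quad_decay f" "quad_decay g" "quad_decay (\<lambda>x. f x * g x)" "\<forall>f \<in> set fs. quad_decay f" "m \<ge> 1"
  shows "nest 0 (f # map (\<lambda>f x. f (x + 1)) (g # fs)) m = nest 0 (f # g # fs) m - nest 0 ((\<lambda>x. f x * g x) # fs) m"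
proof -
  have s: "nest 0 (map (\<lambda>f x. f (x + 1)) (g # fs)) k = nest 0 (g # fs) k - g (real k) * nest 0 fs k"
    if "k \<ge> 1" for k
    using nest_shift[of "g # fs" k] nest_Cons_split[OF assms(4,2) that, of 0] by simp
  have "nest 0 (f # map (\<lambda>f x. f (x + 1)) (g # fs)) m = suminf (\<lambda>k. f (real (m + k)) * nest 0 (g # fs) (m + k)
      - (f (real (m + k)) * g (real (m + k))) * nest 0 fs (m + k))"
    unfolding nest.simps(2)[of 0 f "map _ _"] add_0_right
    using assms(5) by (intro suminf_cong) (simp only: s algebra_simps)
  also have "\<dots> = nest 0 (f # g # fs) m - nest 0 ((\<lambda>x. f x * g x) # fs) m"
    using sums_unique[OF sums_diff[OF summable_sums[OF nest_summable[of "g # fs" f m 0]]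
          summable_sums[OF nest_summable[OF assms(4,3,5), of 0]]]] assms
    unfolding nest.simps(2)[of 0 f] nest.simps(2)[of 0 "\<lambda>x. f x * g x"] add_0_right by auto
  finally show ?thesis .
qed

section \<open>Reduction of the depth\<close>

definition mzv_span :: "nat \<Rightarrow> real set" where
  "mzv_span p = {x. \<exists>lam :: nat list \<Rightarrow> rat. x = (\<Sum>q\<in>{0..p}. \<Sum>s\<in>tuples23 q. of_rat (lam s) * mzv s)}"

lemma finite_tuples23 [simp]: "finite (tuples23 q)"
  using finite_lists_length_eq[of "{2, 3 :: nat}" q] unfolding tuples23_def by (simp add: conj_commute)

lemma mzv_span_zero: "0 \<in> mzv_span p"
  unfolding mzv_span_def by (auto intro!: exI[of _ "\<lambda>_. 0"])

lemma mzv_span_lin: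
  assumes "x \<in> mzv_span p" "y \<in> mzv_span p"
  shows "of_rat c * x + y \<in> mzv_span p"
proof -
  obtain l l' where x: "x = (\<Sum>q\<in>{0..p}. \<Sum>s\<in>tuples23 q. of_rat (l s) * mzv s)"
    and y: "y = (\<Sum>q\<in>{0..p}. \<Sum>s\<in>tuples23 q. of_rat (l' s) * mzv s)"
    using assms unfolding mzv_span_def by blast
  show ?thesis
    unfolding mzv_span_def x y mem_Collect_eq
    by (rule exI[of _ "\<lambda>s. c * l s + l' s"])
       (simp add: of_rat_add of_rat_mult sum.distrib sum_distrib_left algebra_simps)
qed

lemma mzv_span_scale: "x \<in> mzv_span p \<Longrightarrow> of_rat c * x \<in> mzv_span p"
  using mzv_span_lin[of x p 0 c] mzv_span_zero by simp

lemma mzv_span_add: "x \<in> mzv_span p \<Longrightarrow> y \<in> mzv_span p \<Longrightarrow> x + y \<in> mzv_span p"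
  using mzv_span_lin[of x p y 1] by simp

lemma mzv_span_minus: "x \<in> mzv_span p \<Longrightarrow> - x \<in> mzv_span p"
  using mzv_span_scale[of x p "-1"] by (simp add: of_rat_minus)

text \<open>Tuples of length \<open>Suc p\<close> do not occur in \<open>mzv_span p\<close>, so
  their coefficients can be chosen freely: \<open>c\<close> at \<open>\<sigma>\<close> and 0
  elsewhere.\<close>

lemma mzv_span_top:
  assumes "x \<in> mzv_span p" "\<sigma> \<in> tuples23 (Suc p)"
  shows "\<exists>lam :: nat list \<Rightarrow> rat. of_rat c * mzv \<sigma> + x = (\<Sum>q\<in>{0..Suc p}. \<Sum>s\<in>tuples23 q. of_rat (lam s) * mzv s)
    \<and> (\<forall>s\<in>tuples23 (Suc p). s \<noteq> \<sigma> \<longrightarrow> lam s = 0)"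
proof -
  obtain l where x: "x = (\<Sum>q\<in>{0..p}. \<Sum>s\<in>tuples23 q. of_rat (l s) * mzv s)"
    using assms unfolding mzv_span_def by blast
  define lam where "lam s = (if length s = Suc p then if s = \<sigma> then c else 0 else l s)" for s
  have "(\<Sum>s\<in>tuples23 (Suc p). of_rat (lam s) * mzv s) = (\<Sum>s\<in>tuples23 (Suc p). if s = \<sigma> then of_rat c * mzv \<sigma> else 0)"
    by (intro sum.cong) (auto simp: lam_def tuples23_def)
  also have "\<dots> = of_rat c * mzv \<sigma>"
    using assms(2) by simp
  finally have 1: "(\<Sum>s\<in>tuples23 (Suc p). of_rat (lam s) * mzv s) = of_rat c * mzv \<sigma>" .
  have 2: "(\<Sum>q\<in>{0..p}. \<Sum>s\<in>tuples23 q. of_rat (lam s) * mzv s) = x"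
    unfolding x by (intro sum.cong refl) (auto simp: lam_def tuples23_def)
  show ?thesis
    by (rule exI[of _ lam]) (simp add: 1 2, simp add: lam_def tuples23_def)
qed

lemma mzv_span_Suc: "x \<in> mzv_span p \<Longrightarrow> s \<in> tuples23 (Suc p) \<Longrightarrow> of_rat c * mzv s + x \<in> mzv_span (Suc p)"
  using mzv_span_top[of x p s c] unfolding mzv_span_def by blast

lemma mzv_span_mono: "x \<in> mzv_span p \<Longrightarrow> x \<in> mzv_span (Suc p)"
  \<comment> \<open>The tuple of twos is an arbitrary member of the new level and gets coefficient
    0.\<close>
  using mzv_span_Suc[of x p "replicate (Suc p) 2" 0] by (simp add: tuples23_def set_replicate_conv_if)

lemma mzv_Nil: "mzv [] = 1"
proof -
  have "dec_tuples 0 = {[]}" by (auto simp: dec_tuples_def)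
  then show ?thesis by (simp add: mzv_def)
qed

lemma one_in_mzv_span_0: "1 \<in> mzv_span 0"
proof -
  have "tuples23 0 = {[]}" by (auto simp: tuples23_def)
  then show ?thesis unfolding mzv_span_def by (auto simp: mzv_Nil intro!: exI[of _ "\<lambda>_. 1"])
qed

section \<open>Products of factors with separated poles\<close>

text \<open>The poles of successive factors lie in successive disjoint intervals, within \<open>[b, c)\<close>.\<close>

fun chain :: "nat \<Rightarrow> (real \<Rightarrow> real) list \<Rightarrow> nat \<Rightarrow> bool" where
  "chain b [] c \<longleftrightarrow> b \<le> c"
| "chain b (f # fs) c \<longleftrightarrow> (\<exists>d\<ge>b. f \<in> W b d \<and> chain d fs c)"

lemma chain_append: "chain b (xs @ ys) c \<longleftrightarrow> (\<exists>d. chain b xs d \<and> chain d ys c)"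
proof (induction xs arbitrary: b)
  case Nil
  have "chain b ys c" if "b \<le> d" "chain d ys c" for d
    using that by (cases ys) (auto intro: order_trans W_mono)
  then show ?case by auto
qed (simp, blast)

lemma chain_mono: "chain b fs c \<Longrightarrow> b' \<le> b \<Longrightarrow> chain b' fs c"
  using chain_append[of b' "[]" fs c] by auto

lemma chain_mono_right: "chain b fs c \<Longrightarrow> c \<le> c' \<Longrightarrow> chain b fs c'"
  using chain_append[of b fs "[]" c'] unfolding append_Nil2 chain.simps by blast

lemma chain_quad_decay: "chain b fs c \<Longrightarrow> \<forall>f\<in>set fs. quad_decay f"
  by (induction fs arbitrary: b) (auto intro: quad_decay_rspan)

text \<open>Every factor is a single generator, and \<open>Ss\<close> prescribes position by
  position which exponents its pure powers may have.\<close>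

fun gchain :: "nat set list \<Rightarrow> nat \<Rightarrow> (real \<Rightarrow> real) list \<Rightarrow> nat \<Rightarrow> bool" where
  "gchain (S # Ss) b (g # gs) c \<longleftrightarrow> (\<exists>d\<ge>b. g \<in> gens S b d \<and> gchain Ss d gs c)"
| "gchain [] b [] c \<longleftrightarrow> b \<le> c"
| "gchain _ _ _ _ \<longleftrightarrow> False"

text \<open>The linear counterpart of \<open>gchain\<close>. Entries \<open>{2,3}\<close> cover
  every \<open>chain\<close>; singletons record the one exponent that each variable keeps, from
  which the vanishing of the other top coefficients follows.\<close>

fun schain :: "nat set list \<Rightarrow> nat \<Rightarrow> (real \<Rightarrow> real) list \<Rightarrow> nat \<Rightarrow> bool" where
  "schain (S # Ss) b (g # gs) c \<longleftrightarrow> (\<exists>d\<ge>b. g \<in> rspan {0<..} (gens S b d) \<and> schain Ss d gs c)"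
| "schain [] b [] c \<longleftrightarrow> b \<le> c"
| "schain _ _ _ _ \<longleftrightarrow> False"

lemma gchain_imp_chain:
  assumes "gchain Ss b gs c" "\<forall>S\<in>set Ss. S \<subseteq> {2,3}"
  shows "chain b gs c"
  using assms
proof (induction Ss b gs c rule: gchain.induct)
  case (1 S Ss b g gs c)
  then obtain d where d: "b \<le> d" "g \<in> gens S b d" "gchain Ss d gs c" by auto
  then have "g \<in> W b d"
    using 1(3) gens_mono[of S "{2,3}" b b d d] by (auto intro!: rspan_gen)
  then show ?case using 1 d by auto
qed auto

lemma chain_imp_schain: "chain b fs c \<Longrightarrow> schain (replicate (length fs) {2,3}) b fs c"
  by (induction fs arbitrary: b) auto

lemma schain_quad_decay:
  assumes "schain Ss b gs c" "\<forall>S\<in>set Ss. S \<subseteq> {2,3}"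
  shows "\<forall>g\<in>set gs. quad_decay g"
  using assms by (induction Ss b gs c rule: schain.induct) (auto intro: quad_decay_rspan)

text \<open>The factors are expanded one after the other, and each resulting generator joins
  \<open>pre\<close>. The target \<open>X\<close> is kept general because two rational spaces are
  used: \<open>mzv_span\<close>, and its sum with the rational multiples of one fixed multiple zeta
  value.\<close>

lemma nest_multilinear:
  assumes X: "0 \<in> X" "\<And>c x y. x \<in> X \<Longrightarrow> y \<in> X \<Longrightarrow> of_rat c * x + y \<in> X"
    and "schain Ss b fs c" "\<forall>S\<in>set Ss. S \<subseteq> {2,3}" "\<forall>f\<in>set pre. quad_decay f"
    and "\<And>gs. gchain Ss b gs c \<Longrightarrow> nest 0 (pre @ gs) 1 \<in> X"
  shows "nest 0 (pre @ fs) 1 \<in> X"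
  using assms(3-)
proof (induction Ss b fs c arbitrary: pre rule: schain.induct)
  case (1 S Ss b f fs c)
  then obtain d where d: "b \<le> d" "f \<in> rspan {0<..} (gens S b d)" "schain Ss d fs c" by auto
  have S: "S \<subseteq> {2,3}" "\<forall>S\<in>set Ss. S \<subseteq> {2,3}" using 1 by auto
  have qd: "\<forall>f \<in> set pre \<union> set fs. quad_decay f"
    using schain_quad_decay[OF d(3) S(2)] 1 by auto
  from d(2) show ?case
  proof (induction rule: rspan.induct)
    case (zero f)
    then show ?case using nest_zero_position[of f pre fs 1 0] qd X by simp
  next
    case (step g h f c')
    have "nest 0 ((pre @ [g]) @ fs) 1 \<in> X"
    proof (rule "1.IH"[OF d(3) S(2)])
      show "\<forall>f\<in>set (pre @ [g]). quad_decay f"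
        using qd quad_decay_gens[OF S(1) step.hyps(1)] by auto
      show "nest 0 ((pre @ [g]) @ gs) 1 \<in> X" if "gchain Ss d gs c" for gs
        using "1.prems"(4)[of "g # gs"] that step.hyps(1) d(1) by auto
    qed
    moreover have "nest 0 (pre @ f # fs) 1 = of_rat c' * nest 0 (pre @ g # fs) 1 + nest 0 (pre @ h # fs) 1"
    proof (rule nest_lin_position)
      show "f x = of_rat c' * g x + h x" if "x > 0" for x using step.hyps(3) that by simp
      have "f \<in> rspan {0<..} (gens S b d)" by (rule rspan.step[OF step.hyps])
      then show "\<forall>f\<in>{f, g, h} \<union> set pre \<union> set fs. quad_decay f"
        using qd quad_decay_gens[OF S(1) step.hyps(1)] quad_decay_rspan[OF _ S(1)] step.hyps(2) by auto
    qed simp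
    ultimately show ?case using X(2) step.IH by simp
  qed
next
  case (2 b c)
  then show ?case using "2.prems"(4)[of "[]"] by simp
qed auto

text \<open>Summation by parts at the difference leaves sums of depth \<open>p\<close>, to which
  \<open>M\<close> applies: the left neighbour absorbs \<open>pw a s\<close> and the right neighbour
  absorbs \<open>pw (Suc a) s\<close>. Separation of the poles turns both products into admissible
  partial fractions.\<close>

lemma dpw_position:
  assumes M: "\<And>fs c. length fs = p \<Longrightarrow> chain 0 fs c \<Longrightarrow> nest 0 fs 1 \<in> mzv_span p"
    and pre: "chain 0 pre b" and a: "b \<le> a" "Suc a < d" and suf: "chain d suf c"
    and s: "s \<in> {1..3}" and len: "length pre + length suf = p"
  shows "nest 0 (pre @ dpw a s # suf) 1 \<in> mzv_span p"
proof -
  \<comment> \<open>For empty \<open>suf\<close> the second boundary term is absent; the zero function stands for it.\<close>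
  define R where "R = (case suf of [] \<Rightarrow> [\<lambda>_. 0] | f # fs \<Rightarrow> (\<lambda>x. pw (Suc a) s x * f x) # fs)"
  note qd = chain_quad_decay[OF pre] chain_quad_decay[OF suf]
  have R: "(\<forall>f\<in>set R. quad_decay f) \<and> nest 0 (pre @ R) 1 \<in> mzv_span p
    \<and> (\<forall>k\<ge>1. nest 0 (dpw a s # suf) k = pw a s (real k) * nest 0 suf k - nest 0 R k)"
  proof (cases suf)
    case Nil
    have "nest 0 (pre @ [\<lambda>_. 0]) 1 = 0" "\<And>k. k \<ge> 1 \<Longrightarrow> nest 0 [\<lambda>_. 0] k = 0"
      using nest_zero_position[of "\<lambda>_. 0" pre "[]" 1 0] qd
        nest_zero_position[of "\<lambda>_. 0" "[]" "[]" _ 0] by auto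
    moreover have "nest 0 [dpw a s] k = pw a s (real k)" if "k \<ge> 1" for k
      using that s by (intro nest_dpw_Nil) auto
    ultimately show ?thesis
      using Nil mzv_span_zero by (auto simp: R_def quad_decay_zero)
  next
    case (Cons f fs)
    let ?g = "\<lambda>x. pw (Suc a) s x * f x"
    obtain d' where d': "d \<le> d'" "f \<in> W d d'" "chain d' fs c"
      using suf Cons by auto
    \<comment> \<open>The poles of \<open>f\<close> start at \<open>d > Suc a\<close>; the interval
      enlarged down to \<open>Suc a\<close> still avoids those of \<open>pre\<close>.\<close>
    have g: "?g \<in> W (Suc a) d'"
      using d' a s by (intro W_mult_pw[OF d'(2)]) auto
    have "chain 0 (pre @ ?g # fs) c"
      unfolding chain_append
    proof (intro exI[of _ "Suc a"] conjI)
      show "chain 0 pre (Suc a)"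
        using pre a by (auto intro: chain_mono_right)
      show "chain (Suc a) (?g # fs) c"
        using g d' a by (auto intro!: exI[of _ d'])
    qed
    then have "nest 0 (pre @ ?g # fs) 1 \<in> mzv_span p"
      using len Cons by (intro M) auto
    moreover have qg: "quad_decay ?g"
      using quad_decay_rspan[OF g] by simp
    moreover have "nest 0 (dpw a s # f # fs) k = pw a s (real k) * nest 0 (f # fs) k - nest 0 (?g # fs) k"
      if "k \<ge> 1" for k
      using s that qd qg Cons by (intro nest_dpw_Cons) auto
    ultimately show ?thesis
      using qd Cons unfolding R_def by (auto simp del: nest.simps)
  qed
  have D: "nest 0 (dpw a s # suf) k = pw a s (real k) * nest 0 suf k - nest 0 R k" if "k \<ge> 1" for k
    using R that by blast
  show ?thesis
  proof (cases pre rule: rev_cases)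
    case Nil
    have "nest 0 suf 1 \<in> mzv_span p"
      using chain_mono[OF suf] len Nil by (intro M) auto
    \<comment> \<open>Without a left neighbour the sum starts at 1, and the boundary factor is the
      rational number \<open>pw a s 1\<close>.\<close>
    then have "of_rat (1 / (1 + of_nat a) ^ s) * nest 0 suf 1 + (- nest 0 R 1) \<in> mzv_span p"
      using R Nil by (intro mzv_span_lin mzv_span_minus) auto
    then show ?thesis
      using D[of 1] Nil by (simp add: pw_def of_rat_divide of_rat_power of_rat_add del: nest.simps)
  next
    case (snoc pre' f)
    let ?g = "\<lambda>x. pw a s x * f x"
    obtain b0 b1 where b: "chain 0 pre' b0" "b0 \<le> b1" "f \<in> W b0 b1" "b1 \<le> b"
      using pre unfolding snoc chain_append by auto
    \<comment> \<open>The poles of \<open>f\<close> end below \<open>b <= a\<close>; the interval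
      extended up to \<open>Suc a\<close> stays below \<open>d\<close>, where \<open>suf\<close>
      begins.\<close>
    have g: "?g \<in> W b0 (Suc a)"
      using b a s by (intro W_mult_pw[OF b(3)]) auto
    have qg: "quad_decay ?g" using quad_decay_rspan[OF g] by simp
    have qd': "quad_decay (dpw a s)" using s by (intro quad_decay_dpw) auto
    have "chain 0 (pre' @ ?g # suf) c"
      unfolding chain_append chain.simps
      using b g a chain_mono[OF suf, of "Suc a"] by (intro exI[of _ b0] conjI exI[of _ "Suc a"]) auto
    then have 1: "nest 0 (pre' @ ?g # suf) 1 \<in> mzv_span p"
      using len snoc by (intro M) auto
    have "nest 0 (f # dpw a s # suf) k = 1 * nest 0 (?g # suf) k + (- 1) * nest 0 (f # R) k" if k: "k \<ge> 1" for k
    proof -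
      have "nest 0 (f # dpw a s # suf) k
          = suminf (\<lambda>j. ?g (real (k + j)) * nest 0 suf (k + j) - f (real (k + j)) * nest 0 R (k + j))"
        unfolding nest.simps(2)[of 0 f "dpw a s # suf"] add_0_right
        using k by (intro suminf_cong) (simp add: D algebra_simps del: nest.simps)
      also have "\<dots> = nest 0 (?g # suf) k - nest 0 (f # R) k"
        using sums_unique[OF sums_diff[OF summable_sums[OF nest_summable[of suf ?g k 0]]
              summable_sums[OF nest_summable[of R f k 0]]]] qd qg R k snoc
        unfolding nest.simps(2)[of 0 f R] nest.simps(2)[of 0 ?g suf] add_0_right by auto
      finally show ?thesis by simp
    qed
    from nest_append_lin[OF this, of pre' 1]
    have "nest 0 (pre' @ f # dpw a s # suf) 1 = nest 0 (pre' @ ?g # suf) 1 + (- nest 0 (pre' @ f # R) 1)"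
      using qd R qg qd' snoc by auto
    moreover have 2: "- nest 0 (pre' @ f # R) 1 \<in> mzv_span p"
      using R snoc by (intro mzv_span_minus) auto
    ultimately show ?thesis
      using mzv_span_add[OF 1 2] snoc by (simp del: nest.simps)
  qed
qed

section \<open>Pure powers with increasing shifts\<close>

definition pws :: "(nat \<times> nat) list \<Rightarrow> (real \<Rightarrow> real) list" where
  "pws = map (\<lambda>(a, s). pw a s)"

definition incr_from :: "nat \<Rightarrow> (nat \<times> nat) list \<Rightarrow> bool" where
  "incr_from b xs \<longleftrightarrow> sorted_wrt (<) (map fst xs) \<and> (\<forall>(a, s)\<in>set xs. b \<le> a \<and> s \<in> {2,3})"

lemma incr_from_Nil [simp]: "incr_from b []"
  by (simp add: incr_from_def)

lemma incr_from_Cons [simp]: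
  "incr_from b ((a, s) # xs) \<longleftrightarrow> b \<le> a \<and> s \<in> {2,3} \<and> incr_from (Suc a) xs"
  by (fastforce simp: incr_from_def Suc_le_eq)

lemma pws_simps [simp]: "pws [] = []" "pws ((a, s) # xs) = pw a s # pws xs" "length (pws xs) = length xs"
  by (simp_all add: pws_def)

lemma incr_from_imp_chain: "incr_from b xs \<Longrightarrow> \<exists>c. chain b (pws xs) c"
proof (induction xs arbitrary: b)
  case (Cons x xs)
  obtain a s where x: "x = (a, s)" by (cases x)
  from Cons x obtain c where "chain (Suc a) (pws xs) c" by auto
  moreover have "pw a s \<in> W b (Suc a)"
    using Cons.prems x by (auto intro!: rspan_gen pw_in_gens)
  ultimately have "chain b (pws (x # xs)) c"
    using Cons.prems x by (auto intro!: exI[of _ "Suc a"])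
  then show ?case by blast
qed auto

definition up :: "nat \<Rightarrow> (nat \<times> nat) list \<Rightarrow> (nat \<times> nat) list" where
  "up j = map (\<lambda>(a, s). (a + j, s))"

lemma pws_up_1: "pws (up 1 xs) = map (\<lambda>f x. f (x + 1)) (pws xs)"
  by (auto simp: pws_def up_def pw_def fun_eq_iff add_ac)

lemma up_simps [simp]: "up j [] = []" "up j ((a, s) # xs) = (a + j, s) # up j xs" "up 0 xs = xs"
  "length (up j xs) = length xs"
  by (simp_all add: up_def)

lemma up_Suc: "up (Suc j) xs = up 1 (up j xs)"
  by (auto simp: up_def)

lemma incr_from_up: "incr_from b xs \<Longrightarrow> incr_from b (up j xs)"
proof (induction xs arbitrary: b)
  case (Cons x xs)
  obtain a s where x: "x = (a, s)" by (cases x)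
  have "incr_from (Suc a) (up j xs) \<Longrightarrow> incr_from (Suc (a + j)) (up j xs)"
    using Cons.prems x by (fastforce simp: incr_from_def up_def)
  then show ?case using Cons x by auto
qed auto

lemma incr_from_eq_up: "incr_from (b + j) ys \<Longrightarrow> \<exists>zs. incr_from b zs \<and> ys = up j zs"
proof (induction ys arbitrary: b)
  case Nil
  show ?case by (intro exI[of _ "[]"]) simp
next
  case (Cons y ys)
  obtain a s where y: "y = (a, s)" by (cases y)
  then have a: "b + j \<le> a" "s \<in> {2,3}" "incr_from (Suc (a - j) + j) ys" using Cons.prems by auto
  from Cons.IH[OF a(3)] obtain zs where "incr_from (Suc (a - j)) zs" "ys = up j zs" by blast
  then show ?case using a y by (intro exI[of _ "(a - j, s) # zs"]) auto
qed

text \<open>Raising all shifts of the tail removes the terms whose first tail index equals its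
  predecessor, or equals 1 if nothing precedes. There two factors merge, or one becomes a rational
  number, so the removed part has depth \<open>p\<close>.\<close>

lemma nest_up_1:
  assumes M: "\<And>fs c. length fs = p \<Longrightarrow> chain 0 fs c \<Longrightarrow> nest 0 fs 1 \<in> mzv_span p"
    and pre: "chain 0 pre b" and xs: "incr_from b xs" "xs \<noteq> []"
    and len: "length pre + length xs = Suc p"
  shows "nest 0 (pre @ pws (up 1 xs)) 1 - nest 0 (pre @ pws xs) 1 \<in> mzv_span p"
proof -
  obtain a s ys where xs_eq: "xs = (a, s) # ys" using xs(2) by (cases xs) auto
  have as: "b \<le> a" "s \<in> {2,3}" "incr_from (Suc a) ys" using xs xs_eq by auto
  obtain c where c: "chain (Suc a) (pws ys) c" using incr_from_imp_chain[OF as(3)] by blast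
  have qys: "\<forall>f\<in>set (pws ys). quad_decay f" by (rule chain_quad_decay[OF c])
  have qs: "quad_decay (pw a s)" using as by (intro quad_decay_pw) auto
  show ?thesis
  proof (cases pre rule: rev_cases)
    case Nil
    have "nest 0 (pws ys) 1 \<in> mzv_span p"
      using chain_mono[OF c] len Nil xs_eq by (intro M) auto
    then have "of_rat (- 1 / (1 + of_nat a) ^ s) * nest 0 (pws ys) 1 \<in> mzv_span p"
      by (rule mzv_span_scale)
    moreover have "nest 0 (pws (up 1 xs)) 1 = nest 0 (pws xs) (Suc 1)"
      unfolding pws_up_1 by (rule nest_shift)
    moreover have "nest 0 (pws xs) 1 = pw a s 1 * nest 0 (pws ys) 1 + nest 0 (pws xs) (Suc 1)"
      using nest_Cons_split[OF qys qs, of 1 0] xs_eq by (simp del: nest.simps)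
    ultimately show ?thesis
      using Nil by (simp add: pw_def of_rat_divide of_rat_power of_rat_add of_rat_minus del: nest.simps)
  next
    case (snoc pre' f)
    let ?g = "\<lambda>x. f x * pw a s x"
    obtain b0 b1 where b: "chain 0 pre' b0" "b0 \<le> b1" "f \<in> W b0 b1" "b1 \<le> b"
      using pre unfolding snoc chain_append by auto
    have "(\<lambda>x. pw a s x * f x) \<in> W b0 (Suc a)"
      using b as by (intro W_mult_pw[OF b(3)]) auto
    then have g: "?g \<in> W b0 (Suc a)" by (simp add: mult.commute)
    have qg: "quad_decay ?g" using quad_decay_rspan[OF g] by simp
    have qf: "quad_decay f" using quad_decay_rspan[OF b(3)] by simp
    have "chain 0 (pre' @ ?g # pws ys) c"
      unfolding chain_append chain.simps
      using b g as c by (intro exI[of _ b0] conjI exI[of _ "Suc a"]) auto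
    then have 1: "nest 0 (pre' @ ?g # pws ys) 1 \<in> mzv_span p"
      using len snoc xs_eq by (intro M) auto
    have eq: "nest 0 (f # pws (up 1 xs)) k = 1 * nest 0 (f # pws xs) k + (- 1) * nest 0 (?g # pws ys) k" if "k \<ge> 1" for k
      using nest_Cons_shift[OF qf qs qg qys that] unfolding pws_up_1 xs_eq pws_simps by (simp del: nest.simps)
    obtain c' where c': "chain b (pws (up 1 xs)) c'"
      using incr_from_imp_chain[OF incr_from_up[OF xs(1)]] by blast
    have "\<forall>h \<in> set pre' \<union> set (f # pws (up 1 xs)) \<union> set (f # pws xs) \<union> set (?g # pws ys). quad_decay h"
      using chain_quad_decay[OF c'] chain_quad_decay[OF b(1)] qys qs qg qf unfolding xs_eq by auto
    from nest_append_lin[OF eq this, of 1]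
    have "nest 0 (pre' @ f # pws (up 1 xs)) 1 = nest 0 (pre' @ f # pws xs) 1 - nest 0 (pre' @ ?g # pws ys) 1"
      by simp
    then show ?thesis
      using mzv_span_minus[OF 1] snoc by (simp del: nest.simps)
  qed
qed

lemma nest_up:
  assumes M: "\<And>fs c. length fs = p \<Longrightarrow> chain 0 fs c \<Longrightarrow> nest 0 fs 1 \<in> mzv_span p"
    and pre: "chain 0 pre b" and xs: "incr_from b xs" "xs \<noteq> []"
    and len: "length pre + length xs = Suc p"
  shows "nest 0 (pre @ pws (up j xs)) 1 - nest 0 (pre @ pws xs) 1 \<in> mzv_span p"
proof (induction j)
  case 0
  then show ?case by (simp add: mzv_span_zero)
next
  case (Suc j)
  have "nest 0 (pre @ pws (up 1 (up j xs))) 1 - nest 0 (pre @ pws (up j xs)) 1 \<in> mzv_span p"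
    using xs len incr_from_up[OF xs(1)] by (intro nest_up_1[OF M pre]) (auto simp: up_def)
  from mzv_span_add[OF this Suc] show ?case by (simp add: up_Suc[of j xs])
qed

fun staircase :: "nat \<Rightarrow> nat list \<Rightarrow> (nat \<times> nat) list" where
  "staircase i [] = []"
| "staircase i (s # ss) = (i, s) # staircase (Suc i) ss"

text \<open>Adding its shift to each index turns the weak inequalities into strict ones, since
  successive shifts differ by one. With \<open>i = 0\<close> and \<open>m = 1\<close> the right side
  is the nested form of a multiple zeta value.\<close>

lemma nest_staircase: "nest 0 (pws (staircase i ss)) m = nest 1 (map (pw 0) ss) (m + i)"
proof (induction ss arbitrary: i m)
  case (Cons s ss)
  have "pw i s (real (m + k)) = pw 0 s (real (m + i + k))" for k
    by (simp add: pw_def add_ac)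
  then show ?case by (simp add: Cons add_ac)
qed simp

text \<open>The whole remaining list is lowered until its first shift is \<open>i\<close>; that
  factor then joins \<open>pre\<close>. The rest stays at or above \<open>Suc i\<close> because the
  shifts increase strictly. Each lowering changes the sum by an element of
  \<open>mzv_span p\<close>.\<close>

lemma nest_reduce_to_staircase:
  assumes M: "\<And>fs c. length fs = p \<Longrightarrow> chain 0 fs c \<Longrightarrow> nest 0 fs 1 \<in> mzv_span p"
    and "chain 0 pre i" "incr_from i xs" "length pre + length xs = Suc p" "map snd xs = ss"
  shows "nest 0 (pre @ pws xs) 1 - nest 0 (pre @ pws (staircase i ss)) 1 \<in> mzv_span p"
  using assms(2-)
proof (induction ss arbitrary: pre i xs)
  case Nil
  then show ?case by (simp add: mzv_span_zero)
next
  case (Cons s ss)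
  then obtain a ys where xs: "xs = (a, s) # ys" and ys: "map snd ys = ss" by (cases xs) auto
  have a: "i \<le> a" "s \<in> {2,3}" "incr_from (Suc a) ys" using Cons.prems xs by auto
  obtain zs where zs: "incr_from (Suc i) zs" "ys = up (a - i) zs"
    using incr_from_eq_up[of "Suc i" "a - i" ys] a by auto
  have xs': "xs = up (a - i) ((i, s) # zs)" using xs zs a by simp
  have "nest 0 (pre @ pws xs) 1 - nest 0 (pre @ pws ((i, s) # zs)) 1 \<in> mzv_span p"
    unfolding xs' using zs a Cons.prems xs' by (intro nest_up[OF M Cons.prems(1)]) auto
  moreover have "nest 0 ((pre @ [pw i s]) @ pws zs) 1 - nest 0 ((pre @ [pw i s]) @ pws (staircase (Suc i) ss)) 1 \<in> mzv_span p"
  proof (rule Cons.IH)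
    have "pw i s \<in> W i (Suc i)" using a by (auto intro!: rspan_gen pw_in_gens)
    then show "chain 0 (pre @ [pw i s]) (Suc i)"
      unfolding chain_append using Cons.prems(1)
      by (intro exI[of _ i] conjI) (auto intro!: exI[of _ "Suc i"])
  qed (use zs xs ys Cons.prems in \<open>auto simp: up_def comp_def split_beta\<close>)
  ultimately show ?case using mzv_span_add by fastforce
qed

text \<open>The two cases of the depth reduction: either separated intervals force strictly
  increasing shifts of pure powers, or a difference is isolated with the data required by
  \<open>dpw_position\<close>.\<close>

lemma gchain_cases:
  assumes "gchain Ss b gs c" "\<forall>S\<in>set Ss. S \<subseteq> {2,3}"
  obtains (pws) xs where "gs = pws xs" "incr_from b xs" "list_all2 (\<in>) (map snd xs) Ss"
  | (dpw) pre a s suf b' d where "gs = pre @ dpw a s # suf" "chain b pre b'" "b' \<le> a" "Suc a < d"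
      "chain d suf c" "s \<in> {1..3}"
proof -
  have "(\<exists>xs. gs = pws xs \<and> incr_from b xs \<and> list_all2 (\<in>) (map snd xs) Ss) \<or>
    (\<exists>pre a s suf b' d. gs = pre @ dpw a s # suf \<and> chain b pre b' \<and> b' \<le> a \<and> Suc a < d \<and>
      chain d suf c \<and> s \<in> {1..3})"
    using assms
  proof (induction Ss b gs c rule: gchain.induct)
    case (1 S Ss b g gs c)
    then obtain d where d: "b \<le> d" "g \<in> gens S b d" "gchain Ss d gs c" by auto
    have S: "S \<subseteq> {2,3}" "\<forall>S\<in>set Ss. S \<subseteq> {2,3}" using 1 by auto
    from d(2) show ?case
    proof (cases rule: gens_cases)
      case (dpw a s)
      have "g # gs = [] @ dpw a s # gs \<and> chain b [] b \<and> b \<le> a \<and> Suc a < d \<and> chain d gs c \<and> s \<in> {1..3}"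
        using dpw gchain_imp_chain[OF d(3) S(2)] by simp
      then show ?thesis by blast
    next
      case (pw a s)
      from "1.IH"[OF d(3) S(2)] show ?thesis
      proof (elim disjE exE conjE)
        fix xs assume xs: "gs = pws xs" "incr_from d xs" "list_all2 (\<in>) (map snd xs) Ss"
        have "incr_from (Suc a) xs"
          using xs(2) pw by (fastforce simp: incr_from_def)
        then have "g # gs = pws ((a, s) # xs) \<and> incr_from b ((a, s) # xs)
            \<and> list_all2 (\<in>) (map snd ((a, s) # xs)) (S # Ss)"
          using xs pw S by auto
        then show ?thesis by blast
      next
        fix pre a' s' suf b' d'
        assume *: "gs = pre @ dpw a' s' # suf" "chain d pre b'" "b' \<le> a'" "Suc a' < d'"
          "chain d' suf c" "s' \<in> {1..3}"
        have "g \<in> W b d" using d(2) gens_mono[OF S(1), of b b d d] by (auto intro!: rspan_gen)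
        then have "g # gs = (g # pre) @ dpw a' s' # suf \<and> chain b (g # pre) b'"
          using * d(1) by auto
        then show ?thesis using * by blast
      qed
    qed
  qed auto
  then show ?thesis using that by blast
qed

section \<open>Nested sums as sums over tuples\<close>

text \<open>The index set of \<open>nest\<close>, smallest index first. For \<open>m = 1\<close>,
  reversal gives \<open>noninc_tuples\<close> when \<open>e = 0\<close> and
  \<open>dec_tuples\<close> when \<open>e = 1\<close>.\<close>

definition gap_tuples :: "nat \<Rightarrow> nat \<Rightarrow> nat \<Rightarrow> nat list set" where
  "gap_tuples e n m = {l. length l = n \<and> sorted_wrt (\<lambda>x y. x + e \<le> y) l \<and> (\<forall>x\<in>set l. m \<le> x)}"

definition pointwise_prod :: "(real \<Rightarrow> real) list \<Rightarrow> nat list \<Rightarrow> real" where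
  "pointwise_prod fs l = prod_list (map2 (\<lambda>f x. f (real x)) fs l)"

lemma pointwise_prod_simps [simp]:
  "pointwise_prod [] l = 1" "pointwise_prod (f # fs) (x # l) = f (real x) * pointwise_prod fs l"
  by (simp_all add: pointwise_prod_def)

lemma gap_tuples_0: "gap_tuples e 0 m = {[]}"
  by (auto simp: gap_tuples_def)

lemma gap_tuples_Suc:
  "gap_tuples e (Suc n) m = (\<lambda>(k, l). k # l) ` (SIGMA k:{m..}. gap_tuples e n (k + e))"
proof (intro equalityI subsetI)
  fix l assume l: "l \<in> gap_tuples e (Suc n) m"
  then obtain k l' where "l = k # l'" by (cases l) (auto simp: gap_tuples_def)
  then show "l \<in> (\<lambda>(k, l). k # l) ` (SIGMA k:{m..}. gap_tuples e n (k + e))"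
    using l by (auto simp: gap_tuples_def)
qed (fastforce simp: gap_tuples_def)

lemma has_sum_atLeast_nat:
  fixes f :: "nat \<Rightarrow> real"
  assumes "summable (\<lambda>k. \<bar>f (m + k)\<bar>)"
  shows "(f has_sum suminf (\<lambda>k. f (m + k))) {m..}"
proof -
  have "((\<lambda>k. f (m + k)) has_sum suminf (\<lambda>k. f (m + k))) UNIV"
    using norm_summable_imp_has_sum[OF _ summable_sums[OF summable_rabs_cancel[OF assms]]] assms by simp
  also have "?this \<longleftrightarrow> ((f \<circ> (+) m) has_sum suminf (\<lambda>k. f (m + k))) UNIV"
    by (simp add: comp_def)
  also have "\<dots> \<longleftrightarrow> (f has_sum suminf (\<lambda>k. f (m + k))) (range ((+) m))"
    by (subst has_sum_reindex) auto
  also have "range ((+) m) = {m..}"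
    by (auto simp: image_iff le_iff_add)
  finally show ?thesis .
qed

lemma has_sum_nest_Cons:
  assumes "\<forall>f\<in>set fs. quad_decay f" "quad_decay f" "m \<ge> 1"
  shows "((\<lambda>k. f (real k) * nest e fs (k + e)) has_sum nest e (f # fs) m) {m..}"
  using has_sum_atLeast_nat[OF nest_abs_summable[OF assms]] by simp

lemma gap_tuples_inj: "inj_on (\<lambda>(k, l). k # l) A"
  by (auto simp: inj_on_def)

text \<open>For nonnegative terms, convergence of the iterated sums already yields unordered
  summability over the tuples. This case provides the majorant for factors of arbitrary
  sign.\<close>

lemma pointwise_prod_nonneg_has_sum:
  assumes "\<forall>f\<in>set fs. quad_decay f \<and> (\<forall>x>0. f x \<ge> 0)" "m \<ge> 1"
  shows "(pointwise_prod fs has_sum nest e fs m) (gap_tuples e (length fs) m)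
    \<and> (\<forall>l\<in>gap_tuples e (length fs) m. pointwise_prod fs l \<ge> 0)"
  using assms
proof (induction fs arbitrary: m)
  case Nil
  then show ?case by (simp add: gap_tuples_0 has_sum_finite_iff)
next
  case (Cons f fs)
  have IH: "(pointwise_prod fs has_sum nest e fs (k + e)) (gap_tuples e (length fs) (k + e))"
    "\<And>l. l \<in> gap_tuples e (length fs) (k + e) \<Longrightarrow> pointwise_prod fs l \<ge> 0" if "k \<ge> m" for k
    using Cons.IH[of "k + e"] Cons.prems that by auto
  let ?S = "SIGMA k:{m..}. gap_tuples e (length fs) (k + e)"
  let ?F = "\<lambda>(k, l). f (real k) * pointwise_prod fs l"
  have nonneg: "f (real k) * pointwise_prod fs l \<ge> 0"
    if "k \<ge> m" "l \<in> gap_tuples e (length fs) (k + e)" for k l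
    using that Cons.prems IH(2) by auto
  have inner: "((\<lambda>l. ?F (k, l)) has_sum f (real k) * nest e fs (k + e)) (gap_tuples e (length fs) (k + e))"
    if "k \<in> {m..}" for k
    using IH(1)[of k] that by (auto intro!: has_sum_cmult_right)
  have outer: "((\<lambda>k. f (real k) * nest e fs (k + e)) has_sum nest e (f # fs) m) {m..}"
    using Cons.prems by (intro has_sum_nest_Cons) auto
  have summ: "?F summable_on ?S"
    by (rule summable_on_SigmaI[OF inner has_sum_imp_summable[OF outer]]) (use nonneg in simp_all)
  have "(?F has_sum nest e (f # fs) m) ?S"
    by (rule has_sum_SigmaI[OF inner outer summ])
  then have "(pointwise_prod (f # fs) has_sum nest e (f # fs) m) (gap_tuples e (length (f # fs)) m)"
    unfolding list.size(4) add_0_right add_Suc_right gap_tuples_Suc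
    by (subst has_sum_reindex[OF gap_tuples_inj]) (simp add: comp_def case_prod_unfold del: nest.simps)
  moreover have "\<forall>l\<in>gap_tuples e (length (f # fs)) m. pointwise_prod (f # fs) l \<ge> 0"
    using nonneg by (auto simp: gap_tuples_Suc)
  ultimately show ?case by blast
qed

lemma abs_pointwise_prod: "\<bar>pointwise_prod fs l\<bar> = pointwise_prod (map (\<lambda>f x. \<bar>f x\<bar>) fs) l"
proof (induction fs arbitrary: l)
  case (Cons f fs)
  then show ?case by (cases l) (auto simp: abs_mult pointwise_prod_def)
qed simp

lemma pointwise_prod_has_sum:
  assumes "\<forall>f\<in>set fs. quad_decay f" "m \<ge> 1"
  shows "(pointwise_prod fs has_sum nest e fs m) (gap_tuples e (length fs) m)"
  using assms
proof (induction fs arbitrary: m)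
  case Nil
  then show ?case by (simp add: gap_tuples_0 has_sum_finite_iff)
next
  case (Cons f fs)
  let ?S = "SIGMA k:{m..}. gap_tuples e (length fs) (k + e)"
  let ?F = "\<lambda>(k, l). f (real k) * pointwise_prod fs l"
  have reindex: "(pointwise_prod (f # fs) has_sum s) (gap_tuples e (length (f # fs)) m) \<longleftrightarrow> (?F has_sum s) ?S" for s
    unfolding list.size(4) add_0_right add_Suc_right gap_tuples_Suc
    by (subst has_sum_reindex[OF gap_tuples_inj]) (simp add: comp_def case_prod_unfold)
  \<comment> \<open>Absolute values of the factors fall under the nonnegative case; the resulting
    absolute summability justifies iterated evaluation.\<close>
  have "\<forall>h\<in>set (map (\<lambda>f x. \<bar>f x\<bar>) (f # fs)). quad_decay h \<and> (\<forall>x>0. h x \<ge> 0)"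
    using Cons.prems by (auto simp: quad_decay_def)
  from has_sum_imp_summable[OF conjunct1[OF pointwise_prod_nonneg_has_sum[OF this Cons.prems(2), of e]]]
  have "(\<lambda>l. \<bar>pointwise_prod (f # fs) l\<bar>) summable_on gap_tuples e (length (f # fs)) m"
    unfolding abs_pointwise_prod length_map .
  then have "pointwise_prod (f # fs) summable_on gap_tuples e (length (f # fs)) m"
    by (simp add: abs_summable_summable)
  then have summ: "?F summable_on ?S"
    using reindex by (auto simp: summable_on_def)
  show ?case
    unfolding reindex
  proof (rule has_sum_SigmaI[OF _ has_sum_nest_Cons summ])
    show "((\<lambda>l. ?F (k, l)) has_sum f (real k) * nest e fs (k + e)) (gap_tuples e (length fs) (k + e))"
      if "k \<in> {m..}" for k
      using Cons that by (auto intro!: has_sum_cmult_right)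
  qed (use Cons.prems in auto)
qed

lemma pointwise_prod_rev:
  "length fs = length l \<Longrightarrow> pointwise_prod (rev fs) (rev l) = (\<Prod>i<length fs. (fs ! i) (real (l ! i)))"
proof -
  assume len: "length fs = length l"
  then have "pointwise_prod (rev fs) (rev l) = prod_list (rev (map2 (\<lambda>f x. f (real x)) fs l))"
    by (simp add: pointwise_prod_def zip_rev rev_map)
  also have "\<dots> = prod_list (map2 (\<lambda>f x. f (real x)) fs l)"
    by (rule prod_list.rev)
  also have "\<dots> = (\<Prod>i<length fs. (fs ! i) (real (l ! i)))"
    using len by (simp add: prod.list_conv_set_nth atLeast0LessThan)
  finally show ?thesis .
qed

lemma has_sum_rev_gap_tuples:
  assumes "\<forall>f\<in>set fs. quad_decay f"
  shows "((\<lambda>k. \<Prod>i<length fs. (fs ! i) (real (k ! i))) has_sum nest e (rev fs) 1)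
    (rev ` gap_tuples e (length fs) 1)"
proof -
  have "(pointwise_prod (rev fs) has_sum nest e (rev fs) 1) (gap_tuples e (length (rev fs)) 1)"
    using assms by (intro pointwise_prod_has_sum) auto
  then have "((\<lambda>k. pointwise_prod (rev fs) (rev k)) has_sum nest e (rev fs) 1) (rev ` gap_tuples e (length fs) 1)"
    by (subst has_sum_reindex) (auto simp: comp_def inj_on_def)
  also have "?this \<longleftrightarrow> ?thesis"
  proof (rule has_sum_cong)
    fix k assume "k \<in> rev ` gap_tuples e (length fs) 1"
    then have "length fs = length k" by (auto simp: gap_tuples_def)
    then show "pointwise_prod (rev fs) (rev k) = (\<Prod>i<length fs. (fs ! i) (real (k ! i)))"
      by (rule pointwise_prod_rev)
  qed
  finally show ?thesis .
qed

lemma noninc_tuples_eq: "noninc_tuples p = rev ` gap_tuples 0 p 1"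
  by (auto simp: noninc_tuples_def gap_tuples_def sorted_wrt_rev intro!: image_eqI[of _ rev "rev _"])

lemma dec_tuples_eq: "dec_tuples p = rev ` gap_tuples 1 p 1"
  by (auto simp: dec_tuples_def gap_tuples_def sorted_wrt_rev Suc_le_eq intro!: image_eqI[of _ rev "rev _"])

lemma mzv_eq_nest:
  assumes "set s \<subseteq> {2,3}"
  shows "mzv s = nest 1 (map (pw 0) (rev s)) 1"
proof -
  have "((\<lambda>k. \<Prod>i<length (map (pw 0) s). (map (pw 0) s ! i) (real (k ! i))) has_sum nest 1 (rev (map (pw 0) s)) 1)
      (rev ` gap_tuples 1 (length (map (pw 0) s)) 1)"
    using assms by (intro has_sum_rev_gap_tuples) (auto intro!: quad_decay_pw)
  then show ?thesis
    unfolding mzv_def dec_tuples_eq by (simp add: infsumI pw_def rev_map)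
qed

section \<open>Induction on the depth\<close>

lemma nest_pws:
  assumes M: "\<And>fs c. length fs = p \<Longrightarrow> chain 0 fs c \<Longrightarrow> nest 0 fs 1 \<in> mzv_span p"
    and xs: "incr_from 0 xs" "length xs = Suc p"
  shows "nest 0 (pws xs) 1 - mzv (rev (map snd xs)) \<in> mzv_span p"
proof -
  have "set (map snd xs) \<subseteq> {2,3}" using xs(1) by (auto simp: incr_from_def)
  then have "mzv (rev (map snd xs)) = nest 0 (pws (staircase 0 (map snd xs))) 1"
    by (simp add: mzv_eq_nest nest_staircase)
  then show ?thesis
    using nest_reduce_to_staircase[where pre = "[]" and i = 0 and xs = xs, OF M] xs by simp
qed

lemma list_all2_in_tuples:
  "list_all2 (\<in>) xs Ss \<Longrightarrow> \<forall>S\<in>set Ss. S \<subseteq> {2,3} \<Longrightarrow> rev xs \<in> tuples23 (length xs)"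
  by (induction rule: list_all2_induct) (auto simp: tuples23_def)

lemma gchain_length: "gchain Ss b gs c \<Longrightarrow> length gs = length Ss"
  by (induction Ss b gs c rule: gchain.induct) auto

text \<open>Expansion into generators gives pure powers, hence one multiple zeta value modulo
  smaller depth, or a product with a difference, which drops to depth \<open>p\<close>. The
  induction hypothesis supplies \<open>M\<close> in both cases.\<close>

lemma nest_in_mzv_span: "length fs = p \<Longrightarrow> chain 0 fs c \<Longrightarrow> nest 0 fs 1 \<in> mzv_span p"
proof (induction p arbitrary: fs c)
  case 0
  then show ?case using one_in_mzv_span_0 by simp
next
  case (Suc p)
  let ?Ss = "replicate (Suc p) {2,3 :: nat}"
  have Ss: "\<forall>S\<in>set ?Ss. S \<subseteq> {2,3}" by simp
  have "nest 0 ([] @ fs) 1 \<in> mzv_span (Suc p)"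
  proof (rule nest_multilinear[OF mzv_span_zero mzv_span_lin, where Ss = ?Ss])
    show "schain ?Ss 0 fs c" using chain_imp_schain[OF Suc.prems(2)] Suc.prems(1) by simp
    show "nest 0 ([] @ gs) 1 \<in> mzv_span (Suc p)" if gs: "gchain ?Ss 0 gs c" for gs
      using gs Ss
    proof (cases rule: gchain_cases)
      case (pws xs)
      have len: "length xs = Suc p" using gchain_length[OF gs] pws(1) by simp
      have "of_rat 1 * mzv (rev (map snd xs)) + (nest 0 (pws xs) 1 - mzv (rev (map snd xs))) \<in> mzv_span (Suc p)"
        using list_all2_in_tuples[OF pws(3) Ss] len
        by (intro mzv_span_Suc nest_pws[OF Suc.IH pws(2) len]) auto
      then show ?thesis using pws(1) by (simp del: nest.simps)
    next
      case (dpw pre a s suf b' d)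
      have "length pre + length suf = p" using gchain_length[OF gs] dpw(1) by simp
      from dpw_position[OF Suc.IH dpw(2-6) this] show ?thesis
        unfolding dpw(1) by (auto intro: mzv_span_mono)
    qed
  qed auto
  then show ?case by simp
qed

text \<open>With one exponent allowed per position, products of pure powers carry exactly the
  exponents \<open>ss\<close>, so a single value occurs in top depth. The reversal reflects that
  \<open>nest\<close> starts with the smallest index.\<close>

lemma nest_schain_singletons:
  assumes "schain (map (\<lambda>s. {s}) ss) 0 fs c" "length ss = Suc p" "set ss \<subseteq> {2,3}"
  shows "\<exists>\<alpha>. \<exists>z\<in>mzv_span p. nest 0 fs 1 = of_rat \<alpha> * mzv (rev ss) + z"
proof -
  let ?X = "{x. \<exists>\<alpha>. \<exists>z\<in>mzv_span p. x = of_rat \<alpha> * mzv (rev ss) + z}"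
  have Ss: "\<forall>S\<in>set (map (\<lambda>s. {s}) ss). S \<subseteq> {2,3}" using assms(3) by auto
  have "nest 0 ([] @ fs) 1 \<in> ?X"
  proof (rule nest_multilinear[OF _ _ assms(1) Ss])
    show "0 \<in> ?X" using mzv_span_zero by (auto intro!: exI[of _ 0])
    show "of_rat c * x + y \<in> ?X" if "x \<in> ?X" "y \<in> ?X" for c x y
    proof -
      from that obtain a z b w where "z \<in> mzv_span p" "w \<in> mzv_span p"
        "x = of_rat a * mzv (rev ss) + z" "y = of_rat b * mzv (rev ss) + w" by blast
      then show ?thesis
        using mzv_span_lin[of z p w c]
        by (auto intro!: exI[of _ "c * a + b"] bexI[of _ "of_rat c * z + w"]
            simp: of_rat_add of_rat_mult algebra_simps)
    qed
    show "nest 0 ([] @ gs) 1 \<in> ?X" if gs: "gchain (map (\<lambda>s. {s}) ss) 0 gs c" for gs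
      using gs Ss
    proof (cases rule: gchain_cases)
      case (pws xs)
      have len: "length xs = Suc p" using gchain_length[OF gs] pws(1) assms(2) by simp
      have "map snd xs = ss"
        using pws(3) by (auto simp: list_all2_conv_all_nth intro!: nth_equalityI)
      then have "nest 0 (pws xs) 1 - mzv (rev ss) \<in> mzv_span p"
        using nest_pws[OF nest_in_mzv_span pws(2) len] by simp
      then show ?thesis
        using pws(1) by (auto intro!: exI[of _ 1] bexI[of _ "nest 0 (pws xs) 1 - mzv (rev ss)"])
    next
      case (dpw pre a s suf b' d)
      have "length pre + length suf = p" using gchain_length[OF gs] dpw(1) assms(2) by simp
      from dpw_position[OF nest_in_mzv_span dpw(2-6) this] show ?thesis
        unfolding dpw(1) by (auto intro!: exI[of _ 0])
    qed
  qed auto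
  then show ?thesis by simp
qed

section \<open>Polynomials and the symmetry\<close>

abbreviation (input) ev :: "(nat \<Rightarrow> real) \<Rightarrow> rat_mpoly \<Rightarrow> real" where
  "ev \<equiv> mp_eval of_rat"

definition mono_eval :: "(nat \<Rightarrow> real) \<Rightarrow> (nat \<Rightarrow>\<^sub>0 nat) \<Rightarrow> real" where
  "mono_eval x m = (\<Prod>j\<in>Poly_Mapping.keys m. x j ^ Poly_Mapping.lookup m j)"

lemma mono_eval_superset:
  assumes "finite S" "Poly_Mapping.keys m \<subseteq> S"
  shows "mono_eval x m = (\<Prod>j\<in>S. x j ^ Poly_Mapping.lookup m j)"
  unfolding mono_eval_def using assms
  by (intro prod.mono_neutral_left) (auto simp: in_keys_iff)

lemma mono_eval_add: "mono_eval x (m + m') = mono_eval x m * mono_eval x m'"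
proof -
  let ?S = "Poly_Mapping.keys m \<union> Poly_Mapping.keys m'"
  have "mono_eval x (m + m') = (\<Prod>j\<in>?S. x j ^ Poly_Mapping.lookup (m + m') j)"
    by (intro mono_eval_superset) (auto simp: keys_add)
  also have "\<dots> = (\<Prod>j\<in>?S. x j ^ Poly_Mapping.lookup m j) * (\<Prod>j\<in>?S. x j ^ Poly_Mapping.lookup m' j)"
    by (simp add: lookup_add power_add prod.distrib)
  also have "\<dots> = mono_eval x m * mono_eval x m'"
    by (simp add: mono_eval_superset[of ?S])
  finally show ?thesis .
qed

lemma ev_superset:
  assumes "finite S" "Poly_Mapping.keys P \<subseteq> S"
  shows "ev x P = (\<Sum>m\<in>S. of_rat (Poly_Mapping.lookup P m) * mono_eval x m)"
  unfolding mp_eval_def mono_eval_def[symmetric] using assms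
  by (intro sum.mono_neutral_left) (auto simp: in_keys_iff)

lemma ev_add: "ev x (P + Q) = ev x P + ev x Q"
proof -
  let ?S = "Poly_Mapping.keys P \<union> Poly_Mapping.keys Q"
  have "ev x (P + Q) = (\<Sum>m\<in>?S. of_rat (Poly_Mapping.lookup (P + Q) m) * mono_eval x m)"
    by (intro ev_superset) (auto simp: keys_add)
  also have "\<dots> = ev x P + ev x Q"
    by (simp add: ev_superset[of ?S] lookup_add of_rat_add distrib_right sum.distrib)
  finally show ?thesis .
qed

lemma ev_zero: "ev x 0 = 0"
  by (simp add: mp_eval_def)

lemma ev_sum: "ev x (\<Sum>i\<in>I. P i) = (\<Sum>i\<in>I. ev x (P i))"
  by (induction I rule: infinite_finite_induct) (simp_all add: ev_zero ev_add)

lemma ev_single: "ev x (Poly_Mapping.single m c) = of_rat c * mono_eval x m"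
  by (subst ev_superset[of "{m}"]) auto

lemma poly_mapping_eq_sum_single:
  "P = (\<Sum>m\<in>Poly_Mapping.keys P. Poly_Mapping.single m (Poly_Mapping.lookup P m))"
  by (rule poly_mapping_eqI) (auto simp: lookup_sum lookup_single when_def in_keys_iff)

lemma ev_mult: "ev x (P * Q) = ev x P * ev x Q"
proof -
  let ?c = "Poly_Mapping.lookup"
  have "P * Q = (\<Sum>m\<in>Poly_Mapping.keys P. \<Sum>m'\<in>Poly_Mapping.keys Q.
      Poly_Mapping.single (m + m') (?c P m * ?c Q m'))"
    by (subst poly_mapping_eq_sum_single[of P], subst poly_mapping_eq_sum_single[of Q])
       (simp add: sum_product mult_single)
  then have "ev x (P * Q) = (\<Sum>m\<in>Poly_Mapping.keys P. \<Sum>m'\<in>Poly_Mapping.keys Q.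
      (of_rat (?c P m) * mono_eval x m) * (of_rat (?c Q m') * mono_eval x m'))"
    by (simp add: ev_sum ev_single mono_eval_add of_rat_mult mult_ac)
  also have "\<dots> = ev x P * ev x Q"
    unfolding mp_eval_def mono_eval_def[symmetric] by (rule sum_product[symmetric])
  finally show ?thesis .
qed

lemma ev_const: "ev x (mp_const c) = of_rat c"
  by (simp add: mp_const_def ev_single mono_eval_def)

lemma ev_one: "ev x 1 = 1"
  using ev_const[of x 1] by (simp add: mp_const_def)

lemma ev_var: "ev x (mp_var j) = x j"
  by (simp add: mp_var_def ev_single mono_eval_def)

lemma ev_minus: "ev x (- P) = - ev x P"
  using ev_add[of x P "- P"] by (simp add: ev_zero)

lemma ev_diff: "ev x (P - Q) = ev x P - ev x Q"
  using ev_add[of x P "- Q"] by (simp add: ev_minus)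

lemma ev_of_nat: "ev x (of_nat n) = real n"
  by (induction n) (simp_all add: ev_zero ev_add ev_one)

lemma ev_power: "ev x (P ^ n) = ev x P ^ n"
  by (induction n) (simp_all add: ev_one ev_mult)

lemma ev_prod: "ev x (\<Prod>i\<in>I. P i) = (\<Prod>i\<in>I. ev x (P i))"
  by (induction I rule: infinite_finite_induct) (simp_all add: ev_one ev_mult)

text \<open>Evaluation is a ring homomorphism and commutes with the sums, products and powers in the
  substitution. The polynomial symmetry thereby becomes a functional equation for values.\<close>

lemma ev_subst: "ev x (mp_subst i Q P) = ev (x(i := ev x Q)) P"
proof -
  have "ev x (if j = i then Q else mp_var j) = (x(i := ev x Q)) j" for j
    by (simp add: ev_var)
  then show ?thesis
    unfolding mp_subst_def mp_eval_def[of mp_const]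
    by (simp only: ev_sum ev_mult ev_const ev_prod ev_power) (simp only: mp_eval_def)
qed

section \<open>Symmetrised monomials\<close>

lemma lin_prod_interval: "lin_prod (mset_set {r..r + n}) x = pochhammer (x + real r) (n + 1)"
proof -
  have "lin_prod (mset_set {r..r + n}) x = (\<Prod>a\<in>{r..r + n}. x + real a)"
    by (simp add: lin_prod_def prod_unfold_prod_mset)
  also have "\<dots> = (\<Prod>i\<in>{0..<n + 1}. x + real r + real i)"
    by (rule prod.reindex_bij_witness[of _ "\<lambda>i. i + r" "\<lambda>a. a - r"]) auto
  finally show ?thesis by (simp add: pochhammer_prod)
qed

text \<open>The image of \<open>x ^ m\<close> under the projection onto the polynomials with the
  symmetry imposed on \<open>P\<close> in one variable.\<close>

definition sym_monomial :: "nat \<Rightarrow> nat \<Rightarrow> nat \<Rightarrow> nat \<Rightarrow> real \<Rightarrow> real" where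
  "sym_monomial r n \<sigma> m x
    = (x ^ m + (- 1) ^ (n + 1 + \<sigma>) * (- x - 2 * real r - real n) ^ m) / 2"

text \<open>The reflection multiplies the cubed Pochhammer symbol by \<open>(-1) ^ (n + 1)\<close>,
  so the quotient is symmetrised with the sign \<open>(-1) ^ \<sigma>\<close>.\<close>

lemma sym_monomial_rspan:
  assumes "m \<le> 3 * n + 1" "\<sigma> \<in> {2,3}"
  shows "(\<lambda>x. sym_monomial r n \<sigma> m x / pochhammer (x + real r) (n + 1) ^ 3)
    \<in> rspan {0<..} (gens {\<sigma>} r (Suc (r + n)))"
proof -
  let ?A = "mset_set {r..r + n}"
  define g where "g x = x ^ m / pochhammer (x + real r) (n + 1) ^ 3" for x :: real
  \<comment> \<open>Three copies of the interval give multiplicity 3 and degree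
    \<open>3 * n + 3 >= m + 2\<close>.\<close>
  have "(\<lambda>x. x ^ m / lin_prod (?A + ?A + ?A) x) \<in> rspan (pole_free (Suc (r + n))) (gens {2,3} r (Suc (r + n)))"
    using assms(1) by (intro monomial_over_lin_prod_rspan) (auto simp: count_mset_set')
  also have "(\<lambda>x. x ^ m / lin_prod (?A + ?A + ?A) x) = g"
    by (simp add: g_def lin_prod_interval power3_eq_cube fun_eq_iff)
  finally have "(\<lambda>x. g x + (- 1) ^ \<sigma> * g (- x - 2 * real r - real n)) \<in> rspan {0<..} (gens {\<sigma>} r (Suc (r + n)))"
    by (rule rspan_gens_symmetrise[OF _ assms(2)])
  from rspan_scale[OF this, of "1 / 2"] show ?thesis
  proof (rule rspan_cong)
    fix x :: real
    have "pochhammer (- x - 2 * real r - real n + real r) (n + 1) = (- 1) ^ (n + 1) * pochhammer (x + real r) (n + 1)"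
      using pochhammer_minus[of "x + real r + real n" "n + 1"] by (simp add: algebra_simps)
    moreover have "((- 1) ^ (n + 1) * y) ^ 3 = (- 1) ^ (n + 1) * y ^ 3" for y :: real
      by (cases "even n") (simp_all add: power_mult_distrib)
    ultimately have "(- 1) ^ \<sigma> * g (- x - 2 * real r - real n)
        = (- 1) ^ (n + 1 + \<sigma>) * (- x - 2 * real r - real n) ^ m / pochhammer (x + real r) (n + 1) ^ 3"
      unfolding g_def by (cases "even n") (simp_all add: power_add)
    moreover have "(a + b) / 2 / q = of_rat (1 / 2) * (a / q + b / q)" for a b q :: real
      by (simp add: of_rat_divide add_divide_distrib)
    ultimately show "sym_monomial r n \<sigma> m x / pochhammer (x + real r) (n + 1) ^ 3
        = of_rat (1 / 2) * (g x + (- 1) ^ \<sigma> * g (- x - 2 * real r - real n))"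
      by (simp only: sym_monomial_def g_def[of x])
  qed
qed

text \<open>Averaging over the reflection in one variable after the other replaces each monomial by a
  product of symmetrised ones.\<close>

lemma ev_symmetrised:
  fixes n r \<sigma> :: "nat list"
  assumes vars: "mp_vars P \<subseteq> {..<p}"
    and sym: "\<And>i. i < p \<Longrightarrow>
           mp_subst i (- mp_var i - of_nat (2 * (r ! i)) - of_nat (n ! i)) P
             = (- 1) ^ (n ! i + 1 + \<sigma> ! i) * P"
  shows "ev x P = (\<Sum>m\<in>Poly_Mapping.keys P. of_rat (Poly_Mapping.lookup P m) *
    (\<Prod>i<p. sym_monomial (r ! i) (n ! i) (\<sigma> ! i) (Poly_Mapping.lookup m i) (x i)))"
proof -
  let ?c = "Poly_Mapping.lookup P"
  \<comment> \<open>\<open>G l\<close> has the variables below \<open>l\<close> symmetrised, so it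
    leads from \<open>ev x P\<close> at \<open>l = 0\<close> to the claim at
    \<open>l = p\<close>.\<close>
  define G where "G l x = (\<Sum>m\<in>Poly_Mapping.keys P. of_rat (?c m) *
    (\<Prod>i<p. if i < l then sym_monomial (r ! i) (n ! i) (\<sigma> ! i) (Poly_Mapping.lookup m i) (x i)
      else x i ^ Poly_Mapping.lookup m i))" for l and x :: "nat \<Rightarrow> real"
  have symE: "ev (x(i := - x i - 2 * real (r ! i) - real (n ! i))) P = (- 1) ^ (n ! i + 1 + \<sigma> ! i) * ev x P"
    if "i < p" for i x
  proof -
    have "ev x (mp_subst i (- mp_var i - of_nat (2 * (r ! i)) - of_nat (n ! i)) P)
        = ev x ((- 1) ^ (n ! i + 1 + \<sigma> ! i) * P)"
      using sym[OF that] by simp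
    then show ?thesis
      by (simp only: ev_subst ev_diff ev_minus ev_var ev_of_nat ev_mult ev_power ev_one)
         (simp only: of_nat_mult of_nat_numeral)
  qed
  have "G l x = ev x P" if "l \<le> p" for l x
    using that
  proof (induction l arbitrary: x)
    case 0
    have "mono_eval x m = (\<Prod>i<p. x i ^ Poly_Mapping.lookup m i)" if "m \<in> Poly_Mapping.keys P" for m
      using vars that by (intro mono_eval_superset) (auto simp: mp_vars_def)
    then show ?case
      unfolding G_def mp_eval_def mono_eval_def[symmetric] by simp
  next
    case (Suc l)
    let ?\<epsilon> = "(- 1) ^ (n ! l + 1 + \<sigma> ! l) :: real"
    let ?y = "x(l := - x l - 2 * real (r ! l) - real (n ! l))"
    have l: "l \<in> {..<p}" using Suc by simp
    have "(\<Prod>i<p. if i < Suc l then sym_monomial (r ! i) (n ! i) (\<sigma> ! i) (Poly_Mapping.lookup m i) (x i)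
        else x i ^ Poly_Mapping.lookup m i)
      = (\<Prod>i<p. if i < l then sym_monomial (r ! i) (n ! i) (\<sigma> ! i) (Poly_Mapping.lookup m i) (x i)
        else x i ^ Poly_Mapping.lookup m i) / 2
      + ?\<epsilon> * (\<Prod>i<p. if i < l then sym_monomial (r ! i) (n ! i) (\<sigma> ! i) (Poly_Mapping.lookup m i) (?y i)
        else ?y i ^ Poly_Mapping.lookup m i) / 2" (is "prod ?f _ = prod ?g _ / 2 + _ * prod ?h _ / 2") for m
    proof -
      have "prod ?g ({..<p} - {l}) = prod ?f ({..<p} - {l})" "prod ?h ({..<p} - {l}) = prod ?f ({..<p} - {l})"
        by (intro prod.cong; auto)+
      moreover have "?f l = (?g l + ?\<epsilon> * ?h l) / 2"
        by (simp add: sym_monomial_def)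
      ultimately show ?thesis
        unfolding prod.remove[OF finite_lessThan l, of ?f] prod.remove[OF finite_lessThan l, of ?g]
          prod.remove[OF finite_lessThan l, of ?h]
        by (simp only:) (simp only: algebra_simps add_divide_distrib times_divide_eq_left times_divide_eq_right)
    qed
    \<comment> \<open>Symmetrising one more variable averages \<open>G l\<close> over the
      reflection; by induction both values are known, and the sign cancels with that of the
      functional equation.\<close>
    then have "G (Suc l) x = G l x / 2 + ?\<epsilon> * G l ?y / 2"
      unfolding G_def by (simp only: sum_distrib_left sum_divide_distrib sum.distrib[symmetric])
        (intro sum.cong refl, simp only: algebra_simps times_divide_eq_right)
    also have "\<dots> = ev x P / 2 + ?\<epsilon> * (?\<epsilon> * ev x P) / 2"
      using Suc symE[of l x] by simp
    also have "\<dots> = ev x P"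
      by (cases "even (n ! l + 1 + \<sigma> ! l)") simp_all
    finally show ?case .
  qed
  from this[of p x] show ?thesis
    by (simp add: G_def)
qed

text \<open>The poles of factor \<open>i\<close> have shifts from \<open>r ! i\<close> to
  \<open>r ! i + n ! i\<close>, and the condition on \<open>r\<close> orders these intervals by
  decreasing \<open>i\<close>, as \<open>nest\<close> requires. Factor \<open>j\<close> is added at
  the head, so \<open>b\<close> only has to stay below the interval of the current first
  factor.\<close>

lemma schain_rev_map:
  fixes n r \<sigma> :: "nat list"
  assumes "\<And>i. i < p \<Longrightarrow> F i \<in> rspan {0<..} (gens {\<sigma> ! i} (r ! i) (Suc (r ! i + n ! i)))"
    and "\<And>i. i + 1 < p \<Longrightarrow> r ! i \<ge> r ! (i + 1) + n ! (i + 1) + 1"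
    and "j \<le> p" "p \<le> length \<sigma>" "b \<le> (if j = 0 then Suc (r ! 0 + n ! 0) else r ! (j - 1))"
  shows "schain (map (\<lambda>s. {s}) (rev (take j \<sigma>))) b (rev (map F [0..<j])) (Suc (r ! 0 + n ! 0))"
  using assms(3,5)
proof (induction j arbitrary: b)
  case (Suc j)
  have "F j \<in> rspan {0<..} (gens {\<sigma> ! j} b (Suc (r ! j + n ! j)))"
    using Suc.prems by (intro rspan_mono[OF assms(1)[of j]] gens_mono) auto
  moreover have "schain (map (\<lambda>s. {s}) (rev (take j \<sigma>))) (Suc (r ! j + n ! j)) (rev (map F [0..<j])) (Suc (r ! 0 + n ! 0))"
    using Suc.prems assms(2)[of "j - 1"] by (intro Suc.IH) auto
  ultimately show ?case
    using Suc.prems assms(4) by (auto simp: take_Suc_conv_app_nth intro!: exI[of _ "Suc (r ! j + n ! j)"])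
qed auto


section \<open>Summation over the monomials\<close>

lemma mzv_span_combination:
  assumes "finite A" "\<And>m. m \<in> A \<Longrightarrow> \<exists>\<alpha>. \<exists>z\<in>mzv_span p. v m = of_rat \<alpha> * y + z"
  shows "\<exists>\<alpha>. \<exists>z\<in>mzv_span p. (\<Sum>m\<in>A. of_rat (c m) * v m) = of_rat \<alpha> * y + z"
  using assms
proof (induction A rule: finite_induct)
  case empty
  then show ?case using mzv_span_zero by (auto intro!: exI[of _ 0])
next
  case (insert a A)
  obtain \<alpha> z \<beta> w where "z \<in> mzv_span p" "w \<in> mzv_span p"
    "(\<Sum>m\<in>A. of_rat (c m) * v m) = of_rat \<alpha> * y + z" "v a = of_rat \<beta> * y + w"
    using insert.IH insert.prems by blast
  then show ?case
    using insert.hyps mzv_span_lin[of w p z "c a"]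
    by (auto intro!: exI[of _ "c a * \<beta> + \<alpha>"] bexI[of _ "of_rat (c a) * w + z"]
        simp: of_rat_add of_rat_mult algebra_simps)
qed

lemma has_sum_finite_combination:
  fixes f :: "'a \<Rightarrow> 'b \<Rightarrow> real"
  assumes "finite A" "\<And>m. m \<in> A \<Longrightarrow> (f m has_sum v m) B"
  shows "((\<lambda>k. \<Sum>m\<in>A. c m * f m k) has_sum (\<Sum>m\<in>A. c m * v m)) B"
  using assms
proof (induction A rule: finite_induct)
  case (insert a A)
  then have "((\<lambda>k. c a * f a k + (\<Sum>m\<in>A. c m * f m k)) has_sum (c a * v a + (\<Sum>m\<in>A. c m * v m))) B"
    by (intro has_sum_add has_sum_cmult_right) auto
  then show ?case using insert.hyps by simp
qed simp

theorem theorem1p6: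
  fixes p :: nat and n r \<sigma> :: "nat list" and P :: rat_mpoly
  assumes "p \<ge> 1"
    and "length n = p" and "length r = p"
    and "\<And>i. i + 1 < p \<Longrightarrow> r ! i \<ge> r ! (i + 1) + n ! (i + 1) + 1"
    and "mp_vars P \<subseteq> {..<p}"
    and "\<And>i. i < p \<Longrightarrow> mp_degree_in i P \<le> 3 * (n ! i) + 1"
    and "\<sigma> \<in> tuples23 p"
    and "\<And>i. i < p \<Longrightarrow>
           mp_subst i (- mp_var i - of_nat (2 * (r ! i)) - of_nat (n ! i)) P
             = (- 1) ^ (n ! i + 1 + \<sigma> ! i) * P"
  shows "\<exists>lam :: nat list \<Rightarrow> rat.
     ((\<lambda>k. mp_eval of_rat (\<lambda>i. real (k ! i)) P
            / (\<Prod>i<p. pochhammer (real (k ! i) + real (r ! i)) (n ! i + 1) ^ 3))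
        has_sum (\<Sum>q\<in>{0..p}. \<Sum>s\<in>tuples23 q. of_rat (lam s) * mzv s)) (noninc_tuples p)
     \<and> (\<forall>s\<in>tuples23 p. s \<noteq> \<sigma> \<longrightarrow> lam s = 0)"
proof -
  \<comment> \<open>Symmetrisation makes each monomial contribute a product of one-variable
    functions.\<close>
  define F where "F m i = (\<lambda>x. sym_monomial (r ! i) (n ! i) (\<sigma> ! i) (Poly_Mapping.lookup m i) x
      / pochhammer (x + real (r ! i)) (n ! i + 1) ^ 3)" for m :: "nat \<Rightarrow>\<^sub>0 nat" and i
  define v where "v m = nest 0 (rev (map (F m) [0..<p])) 1" for m
  have \<sigma>: "length \<sigma> = p" "set \<sigma> \<subseteq> {2,3}" using assms(7) by (auto simp: tuples23_def)
  obtain p' where p: "p = Suc p'" using assms(1) by (cases p) auto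
  have \<sigma>_nth: "\<sigma> ! i \<in> {2,3}" if "i < p" for i
    using \<sigma>(2) nth_mem[of i \<sigma>] that unfolding \<sigma>(1)[symmetric] by blast
  have F: "F m i \<in> rspan {0<..} (gens {\<sigma> ! i} (r ! i) (Suc (r ! i + n ! i)))"
    if "m \<in> Poly_Mapping.keys P" "i < p" for m i
  proof -
    have "Poly_Mapping.lookup m i \<le> mp_degree_in i P"
      unfolding mp_degree_in_def using that(1) by (intro Max_ge) auto
    also have "\<dots> \<le> 3 * (n ! i) + 1" by (rule assms(6)[OF that(2)])
    finally have "Poly_Mapping.lookup m i \<le> 3 * (n ! i) + 1" .
    then show ?thesis
      unfolding F_def by (rule sym_monomial_rspan[OF _ \<sigma>_nth[OF that(2)]])
  qed
  have decay: "quad_decay (F m i)" if "m \<in> Poly_Mapping.keys P" "i < p" for m i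
    using quad_decay_rspan[OF F[OF that]] \<sigma>_nth[OF that(2)] by simp
  have v_sum: "((\<lambda>k. \<Prod>i<p. F m i (real (k ! i))) has_sum v m) (noninc_tuples p)"
    if "m \<in> Poly_Mapping.keys P" for m
    using has_sum_rev_gap_tuples[of "map (F m) [0..<p]" 0] decay[OF that]
    unfolding noninc_tuples_eq v_def by simp
  \<comment> \<open>Each monomial separately has only \<open>mzv \<sigma>\<close> in depth
    \<open>p\<close>, hence so does their combination.\<close>
  have v: "\<exists>\<alpha>. \<exists>z\<in>mzv_span p'. v m = of_rat \<alpha> * mzv \<sigma> + z" if "m \<in> Poly_Mapping.keys P" for m
  proof -
    have "schain (map (\<lambda>s. {s}) (rev (take p \<sigma>))) 0 (rev (map (F m) [0..<p])) (Suc (r ! 0 + n ! 0))"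
      using assms(4) \<sigma>(1) by (intro schain_rev_map[OF F[OF that]]) auto
    then show ?thesis
      using nest_schain_singletons[of "rev \<sigma>" "rev (map (F m) [0..<p])" _ p'] \<sigma> p
      unfolding v_def by (simp del: upt_Suc)
  qed
  obtain \<alpha> z where z: "z \<in> mzv_span p'"
    "(\<Sum>m\<in>Poly_Mapping.keys P. of_rat (Poly_Mapping.lookup P m) * v m) = of_rat \<alpha> * mzv \<sigma> + z"
    using mzv_span_combination[of "Poly_Mapping.keys P" p' v "mzv \<sigma>" "Poly_Mapping.lookup P", OF finite_keys v]
    by blast
  have ev_P: "mp_eval of_rat x P = (\<Sum>m\<in>Poly_Mapping.keys P. of_rat (Poly_Mapping.lookup P m) *
    (\<Prod>i<p. sym_monomial (r ! i) (n ! i) (\<sigma> ! i) (Poly_Mapping.lookup m i) (x i)))" for x :: "nat \<Rightarrow> real"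
    by (rule ev_symmetrised[OF assms(5,8)])
  have "((\<lambda>k. \<Sum>m\<in>Poly_Mapping.keys P. of_rat (Poly_Mapping.lookup P m) * (\<Prod>i<p. F m i (real (k ! i))))
      has_sum of_rat \<alpha> * mzv \<sigma> + z) (noninc_tuples p)"
    unfolding z(2)[symmetric]
    by (rule has_sum_finite_combination[where f = "\<lambda>m k. \<Prod>i<p. F m i (real (k ! i))", OF finite_keys v_sum])
  also have "(\<lambda>k. \<Sum>m\<in>Poly_Mapping.keys P. of_rat (Poly_Mapping.lookup P m) * (\<Prod>i<p. F m i (real (k ! i))))
    = (\<lambda>k. mp_eval of_rat (\<lambda>i. real (k ! i)) P
            / (\<Prod>i<p. pochhammer (real (k ! i) + real (r ! i)) (n ! i + 1) ^ 3))"
    unfolding ev_P F_def by (simp only: prod_dividef sum_divide_distrib times_divide_eq_right)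
  finally have sum: "((\<lambda>k. mp_eval of_rat (\<lambda>i. real (k ! i)) P
            / (\<Prod>i<p. pochhammer (real (k ! i) + real (r ! i)) (n ! i + 1) ^ 3))
      has_sum of_rat \<alpha> * mzv \<sigma> + z) (noninc_tuples p)" .
  obtain lam where lam: "of_rat \<alpha> * mzv \<sigma> + z = (\<Sum>q\<in>{0..p}. \<Sum>s\<in>tuples23 q. of_rat (lam s) * mzv s)"
    "\<forall>s\<in>tuples23 p. s \<noteq> \<sigma> \<longrightarrow> lam s = 0"
    using mzv_span_top[OF z(1), of \<sigma> \<alpha>] assms(7) unfolding p by blast
  show ?thesis
    using conjI[OF sum[unfolded lam(1)] lam(2)] by (rule exI[of _ lam])
qed

end
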